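(* Let $0<\alpha<2$, $0<\beta\le1$, $H=\alpha/2$, and let $B_{\alpha,\beta}$ be grey Brownian motion. Then, for each fixed $t>0$, the following equalities in law hold (they are equalities of one-dimensional distributions only): $$B_{\alpha,\beta}(t)\overset{d}{=}B\big(E(t^{\alpha/\beta})\big)\overset{d}{=}B\big(S(t^{-\alpha})^{-\beta}\big),$$ where $S$ is a $\beta$-stable subordinator, $E(x)=\inf\{t:\ S(t)>x\}$ is its inverse process, and $B$ is a standard Brownian motion independent of $S$; and $$B_{\alpha,\beta}(t)\overset{d}{=}B_H\big(D_\beta(t^{\alpha/\beta})^{1/\alpha}\big),$$ where $B_H$ is a standard fractional Brownian motion with Hurst parameter $H$ and $D_\beta=\{D_\beta(t),\ t\ge0\}$ is a process independent of $B_H$ with one-dimensional densities $f_{D_\beta(t)}(x)=t^{-\beta}M_\beta(xt^{-\beta})$, $x\ge0$, $t>0$.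
   Context: $E_\beta(x)=\sum_{n\ge0}x^n/\Gamma(\beta n+1)$ is the Mittag-Leffler function (not to be confused with the process $E$), and $M_\beta$ is the M-Wright probability density on $[0,\infty)$, determined by $\int_0^\infty e^{-s\tau}M_\beta(\tau)\,d\tau=E_\beta(-s)$, $s\ge0$ (for $\beta=1$, $M_\beta(\tau)\,d\tau$ is understood as the point mass at $1$). The law of grey Brownian motion at time $t$ is determined by $\mathbb{E}(e^{i\theta B_{\alpha,\beta}(t)})=E_\beta\big(-\frac{\theta^2}{2}t^\alpha\big)$, $\theta\in\mathbb{R}$. The $\beta$-stable subordinator $S$ is the nondecreasing L\'evy process on $[0,\infty)$ with $\mathbb{E}(e^{-sS(t)})=e^{-ts^\beta}$, $s\ge0$ (for $\beta=1$, $S(t)=t$). Standard fractional Brownian motion with Hurst parameter $H=\alpha/2$ is the centered Gaussian process with covariance $\frac12(t^{\alpha}+s^{\alpha}-|t-s|^{\alpha})$. *)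

theory Defs
  imports "HOL-Probability.Probability"
begin

text \<open>
  Processes indexed by time in \<open>[0,\<infinity>)\<close> are functions of type \<open>real \<Rightarrow> 'a \<Rightarrow> real\<close>; their values
  at negative times are never constrained nor used. Path regularity (continuity, right
  continuity, monotonicity) is required of every path, so that a process evaluated at a random
  time is a genuine random variable.
\<close>

definition process :: "'a measure \<Rightarrow> (real \<Rightarrow> 'a \<Rightarrow> real) \<Rightarrow> bool" where
  "process P X \<longleftrightarrow> (\<forall>t\<ge>0. X t \<in> borel_measurable P)"

definition eq_in_law :: "'a measure \<Rightarrow> ('a \<Rightarrow> real) \<Rightarrow> 'b measure \<Rightarrow> ('b \<Rightarrow> real) \<Rightarrow> bool" where
  "eq_in_law P X Q Y \<longleftrightarrow>
     X \<in> borel_measurable P \<and> Y \<in> borel_measurable Q \<and> distr P borel X = distr Q borel Y"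

definition indep_processes ::
  "'a measure \<Rightarrow> (real \<Rightarrow> 'a \<Rightarrow> real) \<Rightarrow> (real \<Rightarrow> 'a \<Rightarrow> real) \<Rightarrow> bool" where
  "indep_processes P X Y \<longleftrightarrow>
     prob_space.indep_var P
       (PiM {0..} (\<lambda>_. borel)) (\<lambda>\<omega>. \<lambda>t\<in>{0..}. X t \<omega>)
       (PiM {0..} (\<lambda>_. borel)) (\<lambda>\<omega>. \<lambda>t\<in>{0..}. Y t \<omega>)"

definition indep_increments :: "'a measure \<Rightarrow> (real \<Rightarrow> 'a \<Rightarrow> real) \<Rightarrow> bool" where
  "indep_increments P X \<longleftrightarrow>
     (\<forall>(n::nat) (u::nat \<Rightarrow> real). 0 \<le> u 0 \<longrightarrow> (\<forall>i<n. u i \<le> u (Suc i)) \<longrightarrow>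
        prob_space.indep_vars P (\<lambda>_. borel) (\<lambda>i \<omega>. X (u (Suc i)) \<omega> - X (u i) \<omega>) {..<n})"

definition mittag_leffler :: "real \<Rightarrow> real \<Rightarrow> real" where
  "mittag_leffler \<beta> x = (\<Sum>n. x ^ n / Gamma (\<beta> * real n + 1))"

text \<open>
  The values of \<open>M\<close> on the negative half-line are irrelevant. For \<open>\<beta> = 1\<close> no such density exists;
  that case is the point mass at \<open>1\<close> and is treated separately below.
\<close>

definition M_Wright_density :: "real \<Rightarrow> (real \<Rightarrow> real) \<Rightarrow> bool" where
  "M_Wright_density \<beta> M \<longleftrightarrow>
     M \<in> borel_measurable borel \<and> (\<forall>\<tau>\<ge>0. 0 \<le> M \<tau>) \<and>
     (\<forall>s\<ge>0. set_integrable lborel {0..} (\<lambda>\<tau>. exp (- s * \<tau>) * M \<tau>) \<and>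
            (LBINT \<tau>:{0..}. exp (- s * \<tau>) * M \<tau>) = mittag_leffler \<beta> (- s))"

text \<open>
  One-dimensional laws of \<open>D\<close>: the image of \<open>M(\<tau>) d\<tau>\<close> under scaling by \<open>t\<^sup>\<beta>\<close>.
\<close>

definition M_Wright_marginals ::
  "'a measure \<Rightarrow> real \<Rightarrow> (real \<Rightarrow> real) \<Rightarrow> (real \<Rightarrow> 'a \<Rightarrow> real) \<Rightarrow> bool" where
  "M_Wright_marginals P \<beta> M D \<longleftrightarrow>
     process P D \<and>
     (\<forall>t>0. if \<beta> = 1 then distr P borel (D t) = return borel (t powr \<beta>)
            else distributed P lborel (D t)
                   (\<lambda>x. ennreal (indicator {0..} x * (t powr (-\<beta>) * M (x * t powr (-\<beta>))))))"

text \<open>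
  Grey Brownian motion enters only through its one-dimensional laws, which are all that is
  prescribed here.
\<close>

definition grey_brownian_motion ::
  "'a measure \<Rightarrow> real \<Rightarrow> real \<Rightarrow> (real \<Rightarrow> 'a \<Rightarrow> real) \<Rightarrow> bool" where
  "grey_brownian_motion P \<alpha> \<beta> X \<longleftrightarrow>
     process P X \<and>
     (\<forall>t\<ge>0. \<forall>\<theta>. (CLINT \<omega>|P. iexp (\<theta> * X t \<omega>))
        = complex_of_real (mittag_leffler \<beta> (- (\<theta>\<^sup>2 / 2) * t powr \<alpha>)))"

definition levy_process :: "'a measure \<Rightarrow> (real \<Rightarrow> 'a \<Rightarrow> real) \<Rightarrow> bool" where
  "levy_process P X \<longleftrightarrow>
     process P X \<and>
     (AE \<omega> in P. X 0 \<omega> = 0) \<and>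
     indep_increments P X \<and>
     (\<forall>s t. 0 \<le> s \<longrightarrow> s \<le> t \<longrightarrow>
        distr P borel (\<lambda>\<omega>. X t \<omega> - X s \<omega>) = distr P borel (X (t - s))) \<and>
     (\<forall>\<omega>\<in>space P. \<forall>t\<ge>0. continuous (at_right t) (\<lambda>u. X u \<omega>)) \<and>
     (\<forall>\<omega>\<in>space P. \<forall>t>0. \<exists>l. ((\<lambda>u. X u \<omega>) \<longlongrightarrow> l) (at_left t))"

text \<open>For \<open>\<beta> = 1\<close> the Laplace transform forces \<open>S t = t\<close> almost surely.\<close>

definition stable_subordinator :: "'a measure \<Rightarrow> real \<Rightarrow> (real \<Rightarrow> 'a \<Rightarrow> real) \<Rightarrow> bool" where
  "stable_subordinator P \<beta> S \<longleftrightarrow>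
     levy_process P S \<and>
     (\<forall>\<omega>\<in>space P. mono_on {0..} (\<lambda>t. S t \<omega>)) \<and>
     (\<forall>t\<ge>0. \<forall>s\<ge>0. (LINT \<omega>|P. exp (- s * S t \<omega>)) = exp (- t * s powr \<beta>))"

text \<open>
  The first passage time is infinite on paths that never exceed \<open>x\<close>. For a stable subordinator
  these form a null set, on which the (real-valued) inverse is set to \<open>0\<close>, as \<open>Inf {}\<close> is an
  unspecified real number.
\<close>

definition inverse_process :: "(real \<Rightarrow> 'a \<Rightarrow> real) \<Rightarrow> real \<Rightarrow> 'a \<Rightarrow> real" where
  "inverse_process S x \<omega> =
     (if \<exists>t\<ge>0. S t \<omega> > x then Inf {t. 0 \<le> t \<and> S t \<omega> > x} else 0)"

definition brownian_motion :: "'a measure \<Rightarrow> (real \<Rightarrow> 'a \<Rightarrow> real) \<Rightarrow> bool" where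
  "brownian_motion P B \<longleftrightarrow>
     process P B \<and>
     (AE \<omega> in P. B 0 \<omega> = 0) \<and>
     indep_increments P B \<and>
     (\<forall>s t. 0 \<le> s \<longrightarrow> s < t \<longrightarrow>
        distributed P lborel (\<lambda>\<omega>. B t \<omega> - B s \<omega>) (normal_density 0 (sqrt (t - s)))) \<and>
     (\<forall>\<omega>\<in>space P. continuous_on {0..} (\<lambda>t. B t \<omega>))"

text \<open>Constants count as (degenerate) Gaussian random variables.\<close>

definition gaussian_rv :: "'a measure \<Rightarrow> ('a \<Rightarrow> real) \<Rightarrow> bool" where
  "gaussian_rv P X \<longleftrightarrow>
     X \<in> borel_measurable P \<and>
     ((\<exists>m. AE \<omega> in P. X \<omega> = m) \<or> (\<exists>m \<sigma>. 0 < \<sigma> \<and> distributed P lborel X (normal_density m \<sigma>)))"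

definition gaussian_process :: "'a measure \<Rightarrow> (real \<Rightarrow> 'a \<Rightarrow> real) \<Rightarrow> bool" where
  "gaussian_process P X \<longleftrightarrow>
     (\<forall>J (c::real \<Rightarrow> real). finite J \<longrightarrow> J \<subseteq> {0..} \<longrightarrow> gaussian_rv P (\<lambda>\<omega>. \<Sum>t\<in>J. c t * X t \<omega>))"

text \<open>Since the process is centered, its covariance is the expectation of the product.\<close>

definition fractional_brownian_motion ::
  "'a measure \<Rightarrow> real \<Rightarrow> (real \<Rightarrow> 'a \<Rightarrow> real) \<Rightarrow> bool" where
  "fractional_brownian_motion P H W \<longleftrightarrow>
     process P W \<and>
     gaussian_process P W \<and>
     (\<forall>t\<ge>0. (LINT \<omega>|P. W t \<omega>) = 0) \<and>
     (\<forall>s\<ge>0. \<forall>t\<ge>0. (LINT \<omega>|P. W t \<omega> * W s \<omega>)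
        = (t powr (2 * H) + s powr (2 * H) - \<bar>t - s\<bar> powr (2 * H)) / 2) \<and>
     (\<forall>\<omega>\<in>space P. continuous_on {0..} (\<lambda>t. W t \<omega>))"

end

theory Submission
  imports Defs
begin

text \<open>
  A Gaussian process evaluated at an independent random time \<open>T\<close> has characteristic function
  \<open>E exp (- \<theta>\<^sup>2/2 v(T))\<close>, where \<open>v\<close> is the variance function, so everything reduces to Laplace
  transforms of the random times. The negative moments
  \<open>E S(v) ^ (- \<beta> n) = n! / (v ^ n \<Gamma>(\<beta> n + 1))\<close>, obtained by writing \<open>\<Gamma>(\<gamma>) S ^ (- \<gamma>)\<close> as an integral of
  \<open>exp (- y S)\<close>, give \<open>E exp (z S(v) powr (- \<beta>))\<close> as a Mittag-Leffler series for every complex \<open>z\<close>.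
  On the imaginary axis this shows that the law of \<open>v S(v) powr (- \<beta>)\<close> does not depend on \<open>v\<close>
  (self-similarity), which turns \<open>P(S(w) > x)\<close>, up to right limits the distribution function of the
  inverse process, into that of \<open>S(x powr (- \<beta>)) powr (- \<beta>)\<close>; for negative \<open>z\<close> it is the
  Laplace transform of that random time.
\<close>

section \<open>Gamma-type integrals\<close>

text \<open>Differentiation telescopes: the derivative of each power term cancels against its
  predecessor in the sum. This gives an explicit antiderivative of w^n exp(-w), from which the next
  integral follows without a change of variables.\<close>

lemma has_real_derivative_exp_partial_sum:
  "((\<lambda>w::real. exp (- w) * (\<Sum>k\<le>n. w ^ k / fact k)) has_real_derivative
     - (exp (- w) * (w ^ n / fact n))) (at w)"
proof (induction n)
  case 0
  show ?case by (auto intro!: derivative_eq_intros)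
next
  case (Suc n)
  have "((\<lambda>w. w ^ Suc n / fact (Suc n)) has_real_derivative w ^ n / fact n) (at w)"
    using DERIV_cdivide[OF DERIV_pow[of "Suc n" w], of "fact (Suc n)"]
    by (simp del: of_nat_Suc add: fact_Suc)
  moreover have "((\<lambda>w. exp (- w)) has_real_derivative - exp (- w)) (at w)"
    by (auto intro!: derivative_eq_intros)
  ultimately have "((\<lambda>w. exp (- w) * (w ^ Suc n / fact (Suc n))) has_real_derivative
      - exp (- w) * (w ^ Suc n / fact (Suc n)) + w ^ n / fact n * exp (- w)) (at w)"
    by (intro DERIV_mult)
  from DERIV_add[OF Suc this] show ?case
    unfolding sum.atMost_Suc distrib_left by (rule DERIV_cong) simp
qed

text \<open>Since the exponent of y is matched to \<beta>, the integrand is, up to constants, w^n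
  exp(-w) dw with w = v y powr \<beta>. The antiderivative of the previous lemma is composed with
  this w, and the fundamental theorem is applied on the open half-line.\<close>

lemma nn_integral_powr_times_exp_powr:
  fixes \<beta> v :: real
  assumes \<beta>: "0 < \<beta>" and v: "0 < v"
  shows "(\<integral>\<^sup>+y. ennreal (indicator {0..} y * (y powr (\<beta> * real (Suc n) - 1) * exp (- v * y powr \<beta>))) \<partial>lborel)
    = ennreal (fact n / (\<beta> * v ^ Suc n))"
proof -
  define c where "c = fact n / (\<beta> * v ^ Suc n)"
  define G where "G w = exp (- w) * (\<Sum>k\<le>n. w ^ k / fact k)" for w :: real
  define f where "f y = y powr (\<beta> * real (Suc n) - 1) * exp (- v * y powr \<beta>)" for y
  \<comment> \<open>The normalisation makes \<open>F\<close> an antiderivative of \<open>f\<close>;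
    as \<open>G\<close> falls from 1 to 0, \<open>F\<close> rises from -c to 0, so the integral is
    c.\<close>
  define F where "F y = - c * G (v * y powr \<beta>)" for y
  have G_lim: "(G \<longlongrightarrow> 0) at_top"
  proof -
    have "((\<lambda>w. \<Sum>k\<le>n. w ^ k / exp w / fact k) \<longlongrightarrow> (\<Sum>k\<le>n. 0 / fact k)) (at_top :: real filter)"
      by (intro tendsto_intros tendsto_power_div_exp_0) simp
    then show ?thesis
      unfolding G_def by (simp add: sum_distrib_left exp_minus field_simps)
  qed
  have F_deriv: "(F has_real_derivative f y) (at y)" if "0 < y" for y
  proof -
    have "((\<lambda>y. G (v * y powr \<beta>)) has_real_derivative
        - (exp (- (v * y powr \<beta>)) * ((v * y powr \<beta>) ^ n / fact n)) * (v * (\<beta> * y powr (\<beta> - 1)))) (at y)"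
      unfolding G_def using \<open>0 < y\<close>
      by (intro DERIV_chain2[OF has_real_derivative_exp_partial_sum])
         (auto intro!: derivative_eq_intros)
    then have "(F has_real_derivative
        - c * (- (exp (- (v * y powr \<beta>)) * ((v * y powr \<beta>) ^ n / fact n)) * (v * (\<beta> * y powr (\<beta> - 1))))) (at y)"
      unfolding F_def by (rule DERIV_cmult)
    also have "- c * (- (exp (- (v * y powr \<beta>)) * ((v * y powr \<beta>) ^ n / fact n)) * (v * (\<beta> * y powr (\<beta> - 1))))
       = (y powr \<beta>) ^ n * y powr (\<beta> - 1) * exp (- v * y powr \<beta>)"
      using \<beta> v by (simp add: c_def power_mult_distrib field_simps)
    also have "(y powr \<beta>) ^ n * y powr (\<beta> - 1) = y powr (\<beta> * real (Suc n) - 1)"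
      using \<open>0 < y\<close> by (simp add: powr_power powr_add[symmetric] algebra_simps)
    finally show ?thesis by (simp add: f_def)
  qed
  have lim_0: "(F \<longlongrightarrow> - c) (at_right 0)"
  proof -
    have "isCont G 0"
      unfolding G_def by (intro continuous_intros) simp_all
    moreover have "((\<lambda>y. v * y powr \<beta>) \<longlongrightarrow> v * 0 powr \<beta>) (at_right 0)"
      using \<beta> by (intro tendsto_intros tendsto_powr') (auto simp: eventually_at_filter)
    ultimately have "((\<lambda>y. G (v * y powr \<beta>)) \<longlongrightarrow> G 0) (at_right 0)"
      using isCont_tendsto_compose by fastforce
    moreover have "G 0 = 1"
      by (simp add: G_def power_0_left if_distrib[of "\<lambda>x. x / _"] cong: if_cong)
    ultimately show ?thesis
      unfolding F_def by (auto intro!: tendsto_eq_intros)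
  qed
  have lim_inf: "(F \<longlongrightarrow> 0) at_top"
  proof -
    have "filterlim (\<lambda>y. v * y powr \<beta>) at_top at_top"
      using \<beta> v by real_asymp
    from filterlim_compose[OF G_lim this] show ?thesis
      unfolding F_def by (auto intro!: tendsto_eq_intros)
  qed
  have int: "set_integrable lborel (einterval 0 \<infinity>) f" and eq: "(LBINT y=0..\<infinity>. f y) = 0 - (- c)"
  proof -
    have "isCont f y" if "0 < y" for y
      unfolding f_def using that by (intro continuous_intros) auto
    moreover have "0 \<le> f y" for y
      by (simp add: f_def)
    moreover have "((F \<circ> real_of_ereal) \<longlongrightarrow> - c) (at_right 0)"
      using lim_0 by (simp add: zero_ereal_def ereal_tendsto_simps)
    moreover have "((F \<circ> real_of_ereal) \<longlongrightarrow> 0) (at_left \<infinity>)"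
      using lim_inf by (simp add: ereal_tendsto_simps)
    ultimately show "set_integrable lborel (einterval 0 \<infinity>) f"
      "(LBINT y=0..\<infinity>. f y) = 0 - (- c)"
      using interval_integral_FTC_nonneg[of 0 \<infinity> F f "- c" 0] F_deriv by auto
  qed
  \<comment> \<open>The closed and open half-lines agree even pointwise, because 0 powr a = 0 gives
    f 0 = 0.\<close>
  have "(\<integral>\<^sup>+y. ennreal (indicator {0..} y * f y) \<partial>lborel) = (\<integral>\<^sup>+y. ennreal (indicator {0<..} y *\<^sub>R f y) \<partial>lborel)"
    by (intro nn_integral_cong) (auto simp: f_def split: split_indicator)
  also have "\<dots> = ennreal (LINT y|lborel. indicator {0<..} y *\<^sub>R f y)"
    using int
    by (intro nn_integral_eq_integral)
       (auto simp: zero_ereal_def set_integrable_def f_def)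
  also have "(LINT y|lborel. indicator {0<..} y *\<^sub>R f y) = c"
    using eq by (simp add: interval_lebesgue_integral_0_infty set_lebesgue_integral_def)
  finally show ?thesis by (simp add: c_def f_def)
qed

text \<open>Euler's integral after rescaling by s. Read from right to left, it writes a negative
  power of s as a mixture of the exponentials exp(-y s), which is how a Laplace transform determines
  negative moments.\<close>

lemma nn_integral_powr_times_exp:
  fixes g s :: real
  assumes g: "0 < g" and s: "0 < s"
  shows "(\<integral>\<^sup>+y. ennreal (indicator {0..} y * (y powr (g - 1) * exp (- y * s))) \<partial>lborel)
    = ennreal (Gamma g * s powr (- g))"
proof -
  let ?I = "\<integral>\<^sup>+y. ennreal (indicator {0..} y * (y powr (g - 1) * exp (- y * s))) \<partial>lborel"
  have "ennreal (Gamma g) = ennreal s * (\<integral>\<^sup>+y. ennreal (indicator {0..} (0 + s * y) * (0 + s * y) powr (g - 1) / exp (0 + s * y)) \<partial>lborel)"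
    using s by (subst Gamma_conv_nn_integral_real[OF g], subst nn_integral_real_affine[where c = s and t = 0]) auto
  also have "(\<integral>\<^sup>+y. ennreal (indicator {0..} (0 + s * y) * (0 + s * y) powr (g - 1) / exp (0 + s * y)) \<partial>lborel)
     = (\<integral>\<^sup>+y. ennreal (s powr (g - 1)) * ennreal (indicator {0..} y * (y powr (g - 1) * exp (- y * s))) \<partial>lborel)"
    using s by (intro nn_integral_cong)
      (auto simp: ennreal_mult[symmetric] powr_mult exp_minus field_simps zero_le_mult_iff split: split_indicator)
  also have "ennreal s * \<dots> = ennreal (s powr g) * ?I"
    using s by (subst nn_integral_cmult)
      (auto simp: mult.assoc[symmetric] ennreal_mult[symmetric] powr_mult_base)
  finally have *: "ennreal (Gamma g) = ennreal (s powr g) * ?I" .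
  have "?I = ennreal (s powr - g) * (ennreal (s powr g) * ?I)"
    using s by (simp add: mult.assoc[symmetric] ennreal_mult[symmetric] powr_add[symmetric])
  also have "\<dots> = ennreal (Gamma g * s powr - g)"
    using g by (simp only: *[symmetric]) (simp add: ennreal_mult[symmetric] mult.commute)
  finally show ?thesis .
qed

text \<open>In Euler's integral keep only u \<ge> A: there u powr y is at least A powr y, and
  exp(-u) has mass exp(-A). Since A is free, \<open>Gamma\<close> outgrows every geometric sequence,
  and no Stirling estimate is involved.\<close>

lemma powr_times_exp_le_Gamma:
  fixes A y :: real
  assumes "0 < A" "0 \<le> y"
  shows "A powr y * exp (- A) \<le> Gamma (y + 1)"
proof -
  have "ennreal (A powr y * exp (- A)) = ennreal (A powr y) * ennreal (exp (- A))"
    by (simp add: ennreal_mult)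
  also have "ennreal (exp (- A)) = (\<integral>\<^sup>+u. ennreal (exp (- u)) * indicator {A..} u \<partial>lborel)"
  proof -
    have "(\<integral>\<^sup>+u. ennreal (exp (- u)) * indicator {A..} u \<partial>lborel) = ennreal (0 - (- exp (- A)))"
    proof (rule nn_integral_FTC_atLeast)
      show "((\<lambda>u. - exp (- u)) \<longlongrightarrow> (0::real)) at_top"
        by real_asymp
    qed (auto intro!: derivative_eq_intros)
    then show ?thesis by simp
  qed
  also have "ennreal (A powr y) * \<dots> = (\<integral>\<^sup>+u. ennreal (A powr y) * (ennreal (exp (- u)) * indicator {A..} u) \<partial>lborel)"
    by (simp add: nn_integral_cmult)
  also have "\<dots> \<le> (\<integral>\<^sup>+u. ennreal (indicator {0..} u * u powr (y + 1 - 1) / exp u) \<partial>lborel)"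
    using assms
    by (intro nn_integral_mono)
       (auto simp: ennreal_mult[symmetric] exp_minus divide_simps intro!: powr_mono2 split: split_indicator)
  also have "\<dots> = ennreal (Gamma (y + 1))"
    using assms by (simp only: Gamma_conv_nn_integral_real)
  finally show ?thesis
    using assms by (subst (asm) ennreal_le_iff) (auto intro: less_imp_le Gamma_real_pos)
qed

lemma summable_mittag_leffler:
  fixes \<beta> s :: real
  assumes "0 < \<beta>" "0 \<le> s"
  shows "summable (\<lambda>n. s ^ n / Gamma (\<beta> * real n + 1))"
proof -
  \<comment> \<open>With this choice A powr (\<beta> n) = (2s + 1)^n, so the terms are at most exp A
    (s / (2s + 1))^n with ratio below 1/2. The summand 1 keeps A positive at s = 0.\<close>
  define A where "A = (2 * s + 1) powr (1 / \<beta>)"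
  have A: "0 < A" "A powr \<beta> = 2 * s + 1"
    using assms by (auto simp: A_def powr_powr)
  have bound: "norm (s ^ n / Gamma (\<beta> * real n + 1)) \<le> exp A * (1 / 2) ^ n" for n
  proof -
    have "A powr (\<beta> * real n) = (2 * s + 1) ^ n"
      using A assms by (simp add: powr_powr[symmetric] powr_realpow)
    then have *: "(2 * s + 1) ^ n * exp (- A) \<le> Gamma (\<beta> * real n + 1)"
      using powr_times_exp_le_Gamma[of A "\<beta> * real n"] A assms by simp
    have "s ^ n / Gamma (\<beta> * real n + 1) \<le> s ^ n / ((2 * s + 1) ^ n * exp (- A))"
      using * assms by (intro divide_left_mono) (auto intro!: mult_pos_pos Gamma_real_pos add_nonneg_pos)
    also have "\<dots> = exp A * (s / (2 * s + 1)) ^ n"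
      by (simp add: exp_minus power_divide field_simps)
    also have "\<dots> \<le> exp A * (1 / 2) ^ n"
      using assms by (intro mult_left_mono power_mono) (auto simp: field_simps)
    finally show ?thesis
      using assms by (simp add: abs_of_pos[OF Gamma_real_pos] add_nonneg_pos)
  qed
  have geometric: "summable (\<lambda>n. exp A * (1 / 2) ^ n)"
    by (intro summable_mult summable_geometric) simp
  show ?thesis
    by (rule summable_comparison_test[OF _ geometric]) (use bound in blast)
qed

section \<open>Negative powers of stable random variables\<close>

text \<open>Expectation and exponential series may be exchanged because the assumed summability is
  that of the expected norms of the terms. Moments given as nonnegative integrals with finite value
  also yield integrability of all powers.\<close>

lemma (in prob_space) expectation_exp_power_series:
  fixes Y :: "'a \<Rightarrow> real" and m :: "nat \<Rightarrow> real" and z :: complex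
  assumes Y[measurable]: "Y \<in> borel_measurable M" and Y_nonneg: "\<And>\<omega>. 0 \<le> Y \<omega>"
    and moment: "\<And>n. (\<integral>\<^sup>+\<omega>. ennreal (Y \<omega> ^ n) \<partial>M) = ennreal (m n)" and m: "\<And>n. 0 \<le> m n"
    and summable: "summable (\<lambda>n. norm z ^ n * m n / fact n)"
  shows "(CLINT \<omega>|M. exp (z * of_real (Y \<omega>))) = (\<Sum>n. z ^ n * of_real (m n / fact n))"
proof -
  let ?f = "\<lambda>n \<omega>. z ^ n / fact n * of_real (Y \<omega> ^ n) :: complex"
  have int: "integrable M (\<lambda>\<omega>. Y \<omega> ^ n)" for n
    using Y_nonneg moment by (intro integrableI_nonneg) auto
  have eq: "(LINT \<omega>|M. Y \<omega> ^ n) = m n" for n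
    using Y_nonneg moment m by (intro integral_eq_nn_integral[THEN trans]) auto
  have exp_eq: "exp (z * of_real (Y \<omega>)) = (\<Sum>n. ?f n \<omega>)" for \<omega>
    by (simp add: exp_def scaleR_conv_of_real power_mult_distrib field_simps)
  have "(CLINT \<omega>|M. (\<Sum>n. ?f n \<omega>)) = (\<Sum>n. CLINT \<omega>|M. ?f n \<omega>)"
  proof (rule integral_suminf)
    show "integrable M (?f n)" for n
      using int by (intro integrable_mult_right integrable_of_real)
    show "AE \<omega> in M. summable (\<lambda>n. norm (?f n \<omega>))"
    proof (rule AE_I2)
      fix \<omega>
      have "summable (\<lambda>n. norm (z * of_real (Y \<omega>)) ^ n /\<^sub>R fact n)"
        by (rule summable_exp_generic)
      then show "summable (\<lambda>n. norm (?f n \<omega>))"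
        by (simp add: norm_mult norm_divide norm_power power_mult_distrib field_simps)
    qed
    have "(LINT \<omega>|M. norm (?f n \<omega>)) = norm z ^ n * m n / fact n" for n
    proof -
      have "(LINT \<omega>|M. norm (?f n \<omega>)) = (LINT \<omega>|M. norm z ^ n / fact n * Y \<omega> ^ n)"
        using Y_nonneg by (intro Bochner_Integration.integral_cong) (auto simp: norm_mult norm_divide norm_power)
      then show ?thesis by (simp add: eq)
    qed
    then show "summable (\<lambda>n. LINT \<omega>|M. norm (?f n \<omega>))"
      using summable by simp
  qed
  also have "(\<lambda>n. CLINT \<omega>|M. ?f n \<omega>) = (\<lambda>n. z ^ n * of_real (m n / fact n))"
    by (simp only: integral_mult_right_zero integral_complex_of_real eq) simp
  finally show ?thesis
    by (simp only: exp_eq)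
qed

text \<open>Almost everywhere on {Y \<le> 0} the variable is 0 and exp(-sY) is 1, so this event has
  probability at most the Laplace transform at s, which vanishes as s grows. Zero has to be excluded
  because 0 powr (-\<beta>) is 0 by convention rather than infinite.\<close>

lemma (in prob_space) AE_pos_of_stretched_exp_laplace:
  fixes Y :: "'a \<Rightarrow> real" and \<beta> v :: real
  assumes Y[measurable]: "Y \<in> borel_measurable M" and Y_nonneg: "AE \<omega> in M. 0 \<le> Y \<omega>"
    and laplace: "\<And>s. 0 \<le> s \<Longrightarrow> (LINT \<omega>|M. exp (- s * Y \<omega>)) = exp (- v * s powr \<beta>)"
    and "0 < \<beta>" "0 < v"
  shows "AE \<omega> in M. 0 < Y \<omega>"
proof -
  have bound: "prob {\<omega> \<in> space M. Y \<omega> \<le> 0} \<le> exp (- v * s powr \<beta>)" if "0 \<le> s" for s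
  proof -
    have "prob {\<omega> \<in> space M. Y \<omega> \<le> 0} = (LINT \<omega>|M. indicator {\<omega> \<in> space M. Y \<omega> \<le> 0} \<omega>)"
      by simp
    also have "\<dots> \<le> (LINT \<omega>|M. exp (- s * Y \<omega>))"
    proof (rule integral_mono_AE)
      show "integrable M (\<lambda>\<omega>. indicator {\<omega> \<in> space M. Y \<omega> \<le> 0} \<omega> :: real)"
        by (intro integrable_const_bound[where B = 1]) (auto split: split_indicator)
      show "integrable M (\<lambda>\<omega>. exp (- s * Y \<omega>))"
        using Y_nonneg that by (intro integrable_const_bound[where B = 1]) auto
      show "AE \<omega> in M. indicator {\<omega> \<in> space M. Y \<omega> \<le> 0} \<omega> \<le> exp (- s * Y \<omega>)"
        using Y_nonneg by eventually_elim (auto split: split_indicator)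
    qed
    finally show ?thesis using laplace[OF that] by simp
  qed
  have "((\<lambda>s. exp (- v * s powr \<beta>)) \<longlongrightarrow> 0) at_top"
    using \<open>0 < \<beta>\<close> \<open>0 < v\<close> by real_asymp
  moreover have "eventually (\<lambda>s. prob {\<omega> \<in> space M. Y \<omega> \<le> 0} \<le> exp (- v * s powr \<beta>)) at_top"
    using bound by (intro eventually_mono[OF eventually_ge_at_top[of 0]])
  ultimately have "prob {\<omega> \<in> space M. Y \<omega> \<le> 0} \<le> 0"
    by (rule tendsto_lowerbound) simp
  then have "prob {\<omega> \<in> space M. Y \<omega> \<le> 0} = 0"
    by (simp add: measure_le_0_iff)
  then have "AE \<omega> in M. \<not> Y \<omega> \<le> 0"
    by (subst (asm) prob_eq_0) auto
  then show ?thesis by (simp add: not_le)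
qed

text \<open>With g = \<beta> n, the product of \<open>Gamma g\<close> and Y powr (-g) is the
  integral of y powr (g - 1) exp(-y Y). Exchanging the integrals by Tonelli brings in the Laplace
  transform of Y, and the remaining integral over y is
  \<open>nn_integral_powr_times_exp_powr\<close>. The case n = 0 is separate because Euler's
  integral requires g > 0.\<close>

lemma (in prob_space) nn_integral_negative_moment:
  fixes Y :: "'a \<Rightarrow> real" and \<beta> v :: real
  assumes Y[measurable]: "Y \<in> borel_measurable M" and Y_nonneg: "AE \<omega> in M. 0 \<le> Y \<omega>"
    and laplace: "\<And>s. 0 \<le> s \<Longrightarrow> (LINT \<omega>|M. exp (- s * Y \<omega>)) = exp (- v * s powr \<beta>)"
    and \<beta>: "0 < \<beta>" and v: "0 < v"
  shows "(\<integral>\<^sup>+\<omega>. ennreal ((Y \<omega> powr (- \<beta>)) ^ n) \<partial>M) = ennreal (fact n / (v ^ n * Gamma (\<beta> * real n + 1)))"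
proof (cases n)
  case 0
  then show ?thesis by (simp add: emeasure_space_1)
next
  case (Suc k)
  define g where "g = \<beta> * real (Suc k)"
  have g: "0 < g" using \<beta> by (simp add: g_def)
  have Gg: "0 < Gamma g" using g by (rule Gamma_real_pos)
  interpret P: pair_sigma_finite lborel M ..
  have Y_pos: "AE \<omega> in M. 0 < Y \<omega>"
    by (rule AE_pos_of_stretched_exp_laplace) fact+
  let ?h = "\<lambda>y. indicator {0..} y * y powr (g - 1)"
  have inner: "(\<integral>\<^sup>+\<omega>. ennreal (?h y * exp (- y * Y \<omega>)) \<partial>M)
      = ennreal (indicator {0..} y * (y powr (g - 1) * exp (- v * y powr \<beta>)))" for y
  proof (cases "0 \<le> y")
    case True
    have "(\<integral>\<^sup>+\<omega>. ennreal (?h y * exp (- y * Y \<omega>)) \<partial>M) = (\<integral>\<^sup>+\<omega>. ennreal (?h y) * ennreal (exp (- y * Y \<omega>)) \<partial>M)"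
      by (simp add: ennreal_mult)
    also have "\<dots> = ennreal (?h y) * (\<integral>\<^sup>+\<omega>. ennreal (exp (- y * Y \<omega>)) \<partial>M)"
      by (rule nn_integral_cmult) simp
    also have "(\<integral>\<^sup>+\<omega>. ennreal (exp (- y * Y \<omega>)) \<partial>M) = ennreal (LINT \<omega>|M. exp (- y * Y \<omega>))"
      using Y_nonneg True
      by (intro nn_integral_eq_integral integrable_const_bound[where B = 1]) auto
    finally show ?thesis
      by (simp only: laplace[OF True]) (simp add: ennreal_mult[symmetric] True)
  qed simp
  have "ennreal (Gamma g) * (\<integral>\<^sup>+\<omega>. ennreal ((Y \<omega> powr (- \<beta>)) ^ n) \<partial>M)
      = (\<integral>\<^sup>+\<omega>. ennreal (Gamma g) * ennreal ((Y \<omega> powr (- \<beta>)) ^ n) \<partial>M)"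
    by (rule nn_integral_cmult[symmetric]) simp
  also have "\<dots> = (\<integral>\<^sup>+\<omega>. (\<integral>\<^sup>+y. ennreal (?h y * exp (- y * Y \<omega>)) \<partial>lborel) \<partial>M)"
  proof (rule nn_integral_cong_AE)
    show "AE \<omega> in M. ennreal (Gamma g) * ennreal ((Y \<omega> powr (- \<beta>)) ^ n)
        = (\<integral>\<^sup>+y. ennreal (?h y * exp (- y * Y \<omega>)) \<partial>lborel)"
      using Y_pos
    proof eventually_elim
      case (elim \<omega>)
      have "(Y \<omega> powr (- \<beta>)) ^ n = Y \<omega> powr (- g)"
        using elim by (simp add: powr_power Suc g_def mult.commute del: power_Suc)
      then show ?case
        using nn_integral_powr_times_exp[OF g elim] Gg by (simp add: ennreal_mult[symmetric] mult.assoc)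
    qed
  qed
  also have "\<dots> = (\<integral>\<^sup>+y. (\<integral>\<^sup>+\<omega>. ennreal (?h y * exp (- y * Y \<omega>)) \<partial>M) \<partial>lborel)"
    by (rule P.Fubini') measurable
  also have "\<dots> = ennreal (fact k / (\<beta> * v ^ Suc k))"
    unfolding inner using nn_integral_powr_times_exp_powr[OF \<beta> v, of k] by (simp only: g_def)
  finally have eq: "ennreal (Gamma g) * (\<integral>\<^sup>+\<omega>. ennreal ((Y \<omega> powr (- \<beta>)) ^ n) \<partial>M)
    = ennreal (fact k / (\<beta> * v ^ Suc k))" .
  have "(\<integral>\<^sup>+\<omega>. ennreal ((Y \<omega> powr (- \<beta>)) ^ n) \<partial>M)
      = ennreal (1 / Gamma g) * (ennreal (Gamma g) * (\<integral>\<^sup>+\<omega>. ennreal ((Y \<omega> powr (- \<beta>)) ^ n) \<partial>M))"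
    using Gg by (simp add: mult.assoc[symmetric] ennreal_mult[symmetric])
  also have "\<dots> = ennreal (1 / Gamma g * (fact k / (\<beta> * v ^ Suc k)))"
    unfolding eq using Gg \<beta> v by (intro ennreal_mult[symmetric]) auto
  also have "1 / Gamma g * (fact k / (\<beta> * v ^ Suc k)) = fact n / (v ^ n * Gamma (\<beta> * real n + 1))"
  proof -
    \<comment> \<open>The factor g = \<beta> n of the recurrence absorbs the 1/\<beta> from the
      integral and turns k! into n! for n = k + 1.\<close>
    have "Gamma (\<beta> * real n + 1) = g * Gamma g"
      using Gamma_plus1[of g] nonpos_Ints_nonpos[of g] g unfolding g_def Suc by linarith
    moreover have "fact n = real (Suc k) * fact k"
      by (simp add: Suc)
    ultimately show ?thesis
      using \<beta> v Gg by (simp add: g_def Suc field_simps del: of_nat_Suc power_Suc)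
  qed
  finally show ?thesis .
qed

text \<open>The n! in the moments cancels the 1/n! of the exponential series, which leaves exactly
  the Mittag-Leffler coefficients. Admitting complex z covers characteristic functions and Laplace
  transforms at once.\<close>

lemma (in prob_space) expectation_exp_negative_power:
  fixes Y :: "'a \<Rightarrow> real" and \<beta> v :: real and z :: complex
  assumes Y[measurable]: "Y \<in> borel_measurable M" and Y_nonneg: "AE \<omega> in M. 0 \<le> Y \<omega>"
    and laplace: "\<And>s. 0 \<le> s \<Longrightarrow> (LINT \<omega>|M. exp (- s * Y \<omega>)) = exp (- v * s powr \<beta>)"
    and \<beta>: "0 < \<beta>" and v: "0 < v"
  shows "(CLINT \<omega>|M. exp (z * of_real (Y \<omega> powr (- \<beta>))))
    = (\<Sum>n. (z / of_real v) ^ n / of_real (Gamma (\<beta> * real n + 1)))"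
proof -
  have G: "0 < Gamma (\<beta> * real n + 1)" for n
    using \<beta> by (intro Gamma_real_pos) (simp add: add_nonneg_pos)
  have "(CLINT \<omega>|M. exp (z * of_real (Y \<omega> powr (- \<beta>))))
    = (\<Sum>n. z ^ n * of_real (fact n / (v ^ n * Gamma (\<beta> * real n + 1)) / fact n))"
  proof (rule expectation_exp_power_series)
    show "(\<integral>\<^sup>+\<omega>. ennreal ((Y \<omega> powr - \<beta>) ^ n) \<partial>M) = ennreal (fact n / (v ^ n * Gamma (\<beta> * real n + 1)))" for n
      by (rule nn_integral_negative_moment) fact+
    show "0 \<le> fact n / (v ^ n * Gamma (\<beta> * real n + 1))" for n
      using v G[of n] by simp
    have "norm z ^ n * (fact n / (v ^ n * Gamma (\<beta> * real n + 1))) / fact n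
        = (norm z / v) ^ n / Gamma (\<beta> * real n + 1)" for n
      by (simp add: power_divide)
    then show "summable (\<lambda>n. norm z ^ n * (fact n / (v ^ n * Gamma (\<beta> * real n + 1))) / fact n)"
      using summable_mittag_leffler[OF \<beta>, of "norm z / v"] v by simp
  qed simp_all
  then show ?thesis by (simp add: power_divide)
qed

lemma (in prob_space) expectation_exp_negative_power_eq_mittag_leffler:
  fixes Y :: "'a \<Rightarrow> real" and \<beta> v s :: real
  assumes Y[measurable]: "Y \<in> borel_measurable M" and Y_nonneg: "AE \<omega> in M. 0 \<le> Y \<omega>"
    and laplace: "\<And>s. 0 \<le> s \<Longrightarrow> (LINT \<omega>|M. exp (- s * Y \<omega>)) = exp (- v * s powr \<beta>)"
    and \<beta>: "0 < \<beta>" and v: "0 < v"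
  shows "(LINT \<omega>|M. exp (s * Y \<omega> powr (- \<beta>))) = mittag_leffler \<beta> (s / v)"
proof -
  have "complex_of_real (LINT \<omega>|M. exp (s * Y \<omega> powr (- \<beta>)))
      = (CLINT \<omega>|M. exp (of_real s * of_real (Y \<omega> powr (- \<beta>))))"
    by (simp add: exp_of_real[symmetric] integral_complex_of_real[symmetric])
  also have "\<dots> = (\<Sum>n. of_real ((s / v) ^ n / Gamma (\<beta> * real n + 1)))"
    by (subst expectation_exp_negative_power[OF assms]) simp_all
  also have "\<dots> = of_real (mittag_leffler \<beta> (s / v))"
  proof -
    have "0 \<le> Gamma (\<beta> * real n + 1)" for n
      using \<beta> by (intro less_imp_le[OF Gamma_real_pos]) (simp add: add_nonneg_pos)
    then have "summable (\<lambda>n. norm ((s / v) ^ n / Gamma (\<beta> * real n + 1)))"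
      using summable_mittag_leffler[OF \<beta>, of "\<bar>s / v\<bar>"] by (simp add: power_abs)
    from suminf_of_real[OF summable_norm_cancel[OF this], symmetric] show ?thesis
      by (simp only: mittag_leffler_def)
  qed
  finally show ?thesis by (simp only: of_real_eq_iff)
qed

lemma char_distr:
  fixes X :: "'a \<Rightarrow> real"
  assumes "X \<in> borel_measurable M"
  shows "char (distr M borel X) \<theta> = (CLINT \<omega>|M. iexp (\<theta> * X \<omega>))"
  using assms by (simp add: char_def integral_distr)

text \<open>Nonnegativity is an almost sure statement: every path is monotone, but paths start at 0
  only almost surely.\<close>

lemma stable_subordinatorD:
  assumes "stable_subordinator Q \<beta> S" "0 \<le> v"
  shows "S v \<in> borel_measurable Q" "AE \<omega> in Q. 0 \<le> S v \<omega>"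
    "\<And>s. 0 \<le> s \<Longrightarrow> (LINT \<omega>|Q. exp (- s * S v \<omega>)) = exp (- v * s powr \<beta>)"
proof -
  show "S v \<in> borel_measurable Q"
    using assms by (auto simp: stable_subordinator_def levy_process_def process_def)
  show "(LINT \<omega>|Q. exp (- s * S v \<omega>)) = exp (- v * s powr \<beta>)" if "0 \<le> s" for s
    using assms that by (auto simp: stable_subordinator_def)
  have "AE \<omega> in Q. S 0 \<omega> = 0"
    using assms by (auto simp: stable_subordinator_def levy_process_def)
  then have "AE \<omega> in Q. \<omega> \<in> space Q \<and> S 0 \<omega> = 0"
    by auto
  then show "AE \<omega> in Q. 0 \<le> S v \<omega>"
  proof eventually_elim
    case (elim \<omega>)
    then have "mono_on {0..} (\<lambda>t. S t \<omega>)"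
      using assms by (auto simp: stable_subordinator_def)
    from mono_onD[OF this, of 0 v] show ?case using elim assms by simp
  qed
qed

text \<open>In the series for the characteristic function, the factor w in front of the random
  variable cancels the division by w coming from the negative moments. The result is free of w, and
  Levy's uniqueness theorem concludes.\<close>

lemma stable_subordinator_self_similar:
  assumes Q: "prob_space Q" and \<beta>: "0 < \<beta>" and S: "stable_subordinator Q \<beta> S"
    and u: "0 < u" and v: "0 < v"
  shows "distr Q borel (\<lambda>\<omega>. u * S u \<omega> powr (- \<beta>)) = distr Q borel (\<lambda>\<omega>. v * S v \<omega> powr (- \<beta>))"
proof -
  interpret Q: prob_space Q by fact
  have meas[measurable]: "S w \<in> borel_measurable Q" if "0 < w" for w
    using stable_subordinatorD[OF S, of w] that by simp
  have char: "char (distr Q borel (\<lambda>\<omega>. w * S w \<omega> powr (- \<beta>))) \<theta>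
      = (\<Sum>n. (\<i> * of_real \<theta>) ^ n / of_real (Gamma (\<beta> * real n + 1)))" if w: "0 < w" for w \<theta>
  proof -
    have [measurable]: "S w \<in> borel_measurable Q" using w by (rule meas)
    have "char (distr Q borel (\<lambda>\<omega>. w * S w \<omega> powr (- \<beta>))) \<theta>
      = (CLINT \<omega>|Q. exp ((\<i> * of_real (\<theta> * w)) * of_real (S w \<omega> powr (- \<beta>))))"
      by (subst char_distr) (simp_all add: mult_ac)
    also have "\<dots> = (\<Sum>n. ((\<i> * of_real (\<theta> * w)) / of_real w) ^ n / of_real (Gamma (\<beta> * real n + 1)))"
      using stable_subordinatorD[OF S, of w] w \<beta> by (intro Q.expectation_exp_negative_power) simp_all
    finally show ?thesis using w by simp
  qed
  show ?thesis
    using meas[OF u] meas[OF v] u v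
    by (intro Levy_uniqueness ext) (simp_all add: char)
qed

section \<open>Independent random times\<close>

text \<open>Divided by n, this rounds x down to the grid of mesh 1/n. The cap n * n, that is time n,
  leaves finitely many values, so expectations at the rounded time are finite sums.\<close>

definition grid_floor :: "nat \<Rightarrow> real \<Rightarrow> nat" where
  "grid_floor n x = min (nat \<lfloor>real n * x\<rfloor>) (n * n)"

lemma measurable_grid_floor[measurable]: "grid_floor n \<in> borel \<rightarrow>\<^sub>M count_space UNIV"
  unfolding grid_floor_def by measurable

lemma grid_floor_tendsto:
  assumes "0 \<le> x"
  shows "(\<lambda>n. real (grid_floor n x) / real n) \<longlonglongrightarrow> x"
proof (rule tendsto_sandwich)
  show "(\<lambda>n. x - 1 / real n) \<longlonglongrightarrow> x"
    by real_asymp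
  \<comment> \<open>The cap is inactive as soon as n \<ge> x.\<close>
  have ev: "\<forall>\<^sub>F n in sequentially. 0 < n \<and> real (grid_floor n x) = of_int \<lfloor>real n * x\<rfloor>"
    using eventually_ge_at_top[of "nat \<lceil>x\<rceil>"] eventually_gt_at_top[of 0]
  proof eventually_elim
    case (elim n)
    have "x \<le> real n" using elim by linarith
    then have "real n * x \<le> real (n * n)"
      by (simp add: mult_left_mono)
    then have "nat \<lfloor>real n * x\<rfloor> \<le> n * n"
      by linarith
    then show ?case
      using elim assms by (simp add: grid_floor_def min_absorb1)
  qed
  show "\<forall>\<^sub>F n in sequentially. x - 1 / real n \<le> real (grid_floor n x) / real n"
    using ev
  proof eventually_elim
    case (elim n)
    have "x - 1 / real n = (real n * x - 1) / real n"
      using elim by (simp add: field_simps)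
    also have "\<dots> \<le> real (grid_floor n x) / real n"
    proof (rule divide_right_mono)
      show "real n * x - 1 \<le> real (grid_floor n x)"
        using elim by linarith
    qed simp
    finally show ?case .
  qed
  show "\<forall>\<^sub>F n in sequentially. real (grid_floor n x) / real n \<le> x"
    using ev
  proof eventually_elim
    case (elim n)
    have "of_int \<lfloor>real n * x\<rfloor> \<le> real n * x" by linarith
    with elim show ?case by (simp add: field_simps)
  qed
qed simp

text \<open>The time \<open>T\<close> is rounded to a finite grid. There the process is a finite sum
  of \<open>W (k / n)\<close> times the indicator of the k-th cell of \<open>T\<close>, which is
  measurable; independence of each single \<open>W u\<close> from \<open>T\<close> factorises every
  summand, and the sum reassembles with the characteristic function in place of the process. Path
  continuity removes the rounding.\<close>

lemma (in prob_space)
  fixes W :: "real \<Rightarrow> 'a \<Rightarrow> real" and T :: "'a \<Rightarrow> real" and v :: "real \<Rightarrow> real"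
  assumes W: "\<And>u. 0 \<le> u \<Longrightarrow> W u \<in> borel_measurable M"
    and W_cont: "\<And>\<omega>. \<omega> \<in> space M \<Longrightarrow> continuous_on {0..} (\<lambda>u. W u \<omega>)"
    and T[measurable]: "T \<in> borel_measurable M" and T_nonneg: "\<And>\<omega>. \<omega> \<in> space M \<Longrightarrow> 0 \<le> T \<omega>"
  shows measurable_at_random_time: "(\<lambda>\<omega>. W (T \<omega>) \<omega>) \<in> borel_measurable M"
    and expectation_iexp_at_random_time:
    "\<lbrakk>\<And>u. 0 \<le> u \<Longrightarrow> indep_var borel (W u) borel T;
      \<And>u. 0 \<le> u \<Longrightarrow> (CLINT \<omega>|M. iexp (\<theta> * W u \<omega>)) = of_real (exp (- (\<theta>\<^sup>2 / 2) * v u));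
      continuous_on {0..} v; \<And>u. 0 \<le> u \<Longrightarrow> 0 \<le> v u\<rbrakk>
     \<Longrightarrow> (CLINT \<omega>|M. iexp (\<theta> * W (T \<omega>) \<omega>)) = of_real (LINT \<omega>|M. exp (- (\<theta>\<^sup>2 / 2) * v (T \<omega>)))"
proof -
  define \<tau> where "\<tau> n \<omega> = real (grid_floor n (T \<omega>)) / real n" for n \<omega>
  define h where "h n k x = (indicator {k} (grid_floor n x) :: real)" for n k and x :: real
  have h_meas[measurable]: "h n k \<in> borel_measurable borel" for n k
    unfolding h_def by (rule measurable_compose[OF measurable_grid_floor]) simp
  \<comment> \<open>Stated for a general algebra because it serves real values of \<open>W\<close>
    and \<open>v\<close> as well as complex exponentials; f may also depend on the sample
    point.\<close>
  have on_grid: "f (\<tau> n \<omega>) = (\<Sum>k\<le>n * n. f (real k / real n) * of_real (h n k (T \<omega>)))"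
    for n \<omega> and f :: "real \<Rightarrow> 'x::{real_algebra_1}"
  proof -
    have "grid_floor n (T \<omega>) \<le> n * n"
      by (simp add: grid_floor_def)
    then have "(\<Sum>k\<le>n * n. if k = grid_floor n (T \<omega>) then f (real k / real n) else 0) = f (\<tau> n \<omega>)"
      by (simp add: \<tau>_def sum.delta)
    also have "(\<Sum>k\<le>n * n. if k = grid_floor n (T \<omega>) then f (real k / real n) else 0)
      = (\<Sum>k\<le>n * n. f (real k / real n) * of_real (h n k (T \<omega>)))"
      by (rule sum.cong) (auto simp: h_def)
    finally show ?thesis ..
  qed
  have \<tau>_lim: "(\<lambda>n. \<tau> n \<omega>) \<longlonglongrightarrow> T \<omega>" if "\<omega> \<in> space M" for \<omega>
    unfolding \<tau>_def using T_nonneg[OF that] by (rule grid_floor_tendsto)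
  have \<tau>_nonneg: "0 \<le> \<tau> n \<omega>" for n \<omega>
    by (simp add: \<tau>_def)
  have [measurable]: "W (real k / real n) \<in> borel_measurable M" for k n
    by (rule W) simp
  have W_\<tau>_meas[measurable]: "(\<lambda>\<omega>. W (\<tau> n \<omega>) \<omega>) \<in> borel_measurable M" for n
    unfolding on_grid[of "\<lambda>u. W u _"] by simp
  have along_\<tau>: "(\<lambda>n. f (\<tau> n \<omega>)) \<longlonglongrightarrow> f (T \<omega>)" if "continuous_on {0..} f" "\<omega> \<in> space M"
    for f :: "real \<Rightarrow> real" and \<omega>
    using that \<tau>_nonneg T_nonneg
    by (intro continuous_on_tendsto_compose[OF that(1) \<tau>_lim]) auto
  have W_\<tau>_lim: "(\<lambda>n. W (\<tau> n \<omega>) \<omega>) \<longlonglongrightarrow> W (T \<omega>) \<omega>" if "\<omega> \<in> space M" for \<omega>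
    using along_\<tau>[OF W_cont[OF that] that] .
  show W_T_meas[measurable]: "(\<lambda>\<omega>. W (T \<omega>) \<omega>) \<in> borel_measurable M"
    by (rule borel_measurable_LIMSEQ_real[OF W_\<tau>_lim]) simp_all
  assume indep: "\<And>u. 0 \<le> u \<Longrightarrow> indep_var borel (W u) borel T"
    and char: "\<And>u. 0 \<le> u \<Longrightarrow> (CLINT \<omega>|M. iexp (\<theta> * W u \<omega>)) = of_real (exp (- (\<theta>\<^sup>2 / 2) * v u))"
    and v_cont: "continuous_on {0..} v" and v_nonneg: "\<And>u. 0 \<le> u \<Longrightarrow> 0 \<le> v u"
  let ?e = "\<lambda>u. exp (- (\<theta>\<^sup>2 / 2) * v u)"
  \<comment> \<open>Continuity of \<open>v\<close> is known on the half-line only, so measurability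
    of \<open>v\<close> at the random time also comes from the grid approximation.\<close>
  have v_\<tau>_meas[measurable]: "(\<lambda>\<omega>. v (\<tau> n \<omega>)) \<in> borel_measurable M" for n
    unfolding on_grid[of v] by simp
  have v_T_meas[measurable]: "(\<lambda>\<omega>. v (T \<omega>)) \<in> borel_measurable M"
    by (rule borel_measurable_LIMSEQ_real[OF along_\<tau>[OF v_cont]]) simp_all
  have grid: "(CLINT \<omega>|M. iexp (\<theta> * W (\<tau> n \<omega>) \<omega>)) = (CLINT \<omega>|M. of_real (?e (\<tau> n \<omega>)))" for n
  proof -
    have int_h: "integrable M (\<lambda>\<omega>. of_real (h n k (T \<omega>)) :: complex)" for k
    proof (rule integrable_const_bound[where B = 1])
      show "AE \<omega> in M. norm (of_real (h n k (T \<omega>)) :: complex) \<le> 1"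
        by (simp add: h_def)
    qed simp
    have int_W: "integrable M (\<lambda>\<omega>. iexp (\<theta> * W (real k / real n) \<omega>))" for k
      by (intro integrable_iexp) auto
    have ind: "indep_var borel (\<lambda>\<omega>. iexp (\<theta> * W (real k / real n) \<omega>)) borel (\<lambda>\<omega>. of_real (h n k (T \<omega>)) :: complex)" for k
      using indep_var_compose[OF indep, of "real k / real n" "\<lambda>x. iexp (\<theta> * x)" borel
          "\<lambda>x. of_real (h n k x) :: complex" borel]
      by (simp add: comp_def)
    have "(CLINT \<omega>|M. iexp (\<theta> * W (\<tau> n \<omega>) \<omega>))
       = (CLINT \<omega>|M. (\<Sum>k\<le>n * n. iexp (\<theta> * W (real k / real n) \<omega>) * of_real (h n k (T \<omega>))))"
      by (subst on_grid[of "\<lambda>u. iexp (\<theta> * W u _)"]) simp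
    also have "\<dots> = (\<Sum>k\<le>n * n. CLINT \<omega>|M. iexp (\<theta> * W (real k / real n) \<omega>) * of_real (h n k (T \<omega>)))"
      by (intro Bochner_Integration.integral_sum indep_var_integrable ind int_h int_W)
    also have "\<dots> = (\<Sum>k\<le>n * n. of_real (?e (real k / real n)) * (CLINT \<omega>|M. of_real (h n k (T \<omega>))))"
      by (intro sum.cong refl)
         (subst indep_var_lebesgue_integral[OF ind int_W int_h], subst char, simp_all)
    also have "\<dots> = (CLINT \<omega>|M. (\<Sum>k\<le>n * n. of_real (?e (real k / real n)) * of_real (h n k (T \<omega>))))"
      using int_h by (subst Bochner_Integration.integral_sum) simp_all
    also have "\<dots> = (CLINT \<omega>|M. of_real (?e (\<tau> n \<omega>)))"
      by (subst on_grid[of "\<lambda>u. of_real (?e u)"]) simp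
    finally show ?thesis .
  qed
  \<comment> \<open>Both sides pass to the limit with dominating constant 1: on the left the
    exponential is unimodular, on the right v \<ge> 0 bounds it by 1.\<close>
  have "(\<lambda>n. CLINT \<omega>|M. iexp (\<theta> * W (\<tau> n \<omega>) \<omega>)) \<longlonglongrightarrow> (CLINT \<omega>|M. iexp (\<theta> * W (T \<omega>) \<omega>))"
  proof (rule integral_dominated_convergence[where w = "\<lambda>_. 1"])
    show "AE \<omega> in M. (\<lambda>n. iexp (\<theta> * W (\<tau> n \<omega>) \<omega>)) \<longlonglongrightarrow> iexp (\<theta> * W (T \<omega>) \<omega>)"
      by (intro AE_I2 tendsto_intros W_\<tau>_lim)
  qed (simp_all del: of_real_mult)
  moreover have "(\<lambda>n. CLINT \<omega>|M. of_real (?e (\<tau> n \<omega>))) \<longlonglongrightarrow> (CLINT \<omega>|M. of_real (?e (T \<omega>)))"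
  proof (rule integral_dominated_convergence[where w = "\<lambda>_. 1"])
    show "AE \<omega> in M. (\<lambda>n. complex_of_real (?e (\<tau> n \<omega>))) \<longlonglongrightarrow> of_real (?e (T \<omega>))"
      by (intro AE_I2 tendsto_intros along_\<tau>[OF v_cont])
    show "AE \<omega> in M. norm (complex_of_real (?e (\<tau> n \<omega>))) \<le> 1" for n
      by (simp add: v_nonneg \<tau>_nonneg)
  qed simp_all
  ultimately have "(CLINT \<omega>|M. iexp (\<theta> * W (T \<omega>) \<omega>)) = (CLINT \<omega>|M. of_real (?e (T \<omega>)))"
    unfolding grid by (rule LIMSEQ_unique)
  then show "(CLINT \<omega>|M. iexp (\<theta> * W (T \<omega>) \<omega>)) = of_real (LINT \<omega>|M. ?e (T \<omega>))"
    by (simp only: integral_complex_of_real)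
qed

section \<open>One-dimensional characteristic functions of the Gaussian processes\<close>

lemma (in prob_space) expectation_iexp_normal:
  assumes X: "distributed M lborel X (normal_density 0 \<sigma>)" and \<sigma>: "0 < \<sigma>"
  shows "(CLINT \<omega>|M. iexp (\<theta> * X \<omega>)) = of_real (exp (- (\<theta>\<^sup>2 / 2) * \<sigma>\<^sup>2))"
proof -
  have std: "distributed M lborel (\<lambda>\<omega>. X \<omega> / \<sigma>) std_normal_density"
    using X normal_standard_normal_convert[OF \<sigma>, of X 0] by simp
  have "(CLINT \<omega>|M. iexp (\<theta> * X \<omega>)) = (CLINT \<omega>|M. iexp ((\<theta> * \<sigma>) * (X \<omega> / \<sigma>)))"
    using \<sigma> by simp
  also have "\<dots> = (CLINT x|distr M lborel (\<lambda>\<omega>. X \<omega> / \<sigma>). iexp ((\<theta> * \<sigma>) * x))"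
    using distributed_measurable[OF std] by (subst integral_distr) simp_all
  also have "\<dots> = char std_normal_distribution (\<theta> * \<sigma>)"
    by (simp add: distributed_distr_eq_density[OF std] char_def)
  also have "\<dots> = of_real (exp (- (\<theta>\<^sup>2 / 2) * \<sigma>\<^sup>2))"
    by (simp add: char_std_normal_distribution power_mult_distrib)
  finally show ?thesis .
qed

lemma brownian_motion_expectation_iexp:
  assumes "prob_space Q" and B: "brownian_motion Q B" and u: "0 \<le> u"
  shows "(CLINT \<omega>|Q. iexp (\<theta> * B u \<omega>)) = of_real (exp (- (\<theta>\<^sup>2 / 2) * u))"
proof -
  interpret Q: prob_space Q by fact
  have B0: "AE \<omega> in Q. B 0 \<omega> = 0" and meas: "\<And>t. 0 \<le> t \<Longrightarrow> B t \<in> borel_measurable Q"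
    using B by (auto simp: brownian_motion_def process_def)
  note [measurable] = meas[OF u] meas[OF order_refl]
  \<comment> \<open>The definition prescribes densities of increments over nondegenerate intervals,
    so \<open>B u\<close> becomes the increment from 0, and u = 0 is treated by hand.\<close>
  have "(CLINT \<omega>|Q. iexp (\<theta> * B u \<omega>)) = (CLINT \<omega>|Q. iexp (\<theta> * (B u \<omega> - B 0 \<omega>)))"
    using B0 by (intro integral_cong_AE) auto
  also have "\<dots> = of_real (exp (- (\<theta>\<^sup>2 / 2) * u))"
  proof (cases "u = 0")
    case True
    then show ?thesis by (simp add: Q.prob_space)
  next
    case False
    have "\<forall>s t. 0 \<le> s \<longrightarrow> s < t \<longrightarrow>
        distributed Q lborel (\<lambda>\<omega>. B t \<omega> - B s \<omega>) (normal_density 0 (sqrt (t - s)))"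
      using B by (simp add: brownian_motion_def)
    from this[rule_format, of 0 u]
    have "distributed Q lborel (\<lambda>\<omega>. B u \<omega> - B 0 \<omega>) (normal_density 0 (sqrt u))"
      using u False by simp
    from Q.expectation_iexp_normal[OF this] show ?thesis
      using u False by simp
  qed
  finally show ?thesis .
qed

text \<open>A centered Gaussian variable is determined by its second moment, here the covariance on
  the diagonal. In the degenerate case the mean forces the constant 0, and the covariance then
  forces u powr (2H) = 0, so the same formula holds.\<close>

lemma fractional_brownian_motion_expectation_iexp:
  assumes "prob_space R" and W: "fractional_brownian_motion R H W" and u: "0 \<le> u"
  shows "(CLINT \<omega>|R. iexp (\<theta> * W u \<omega>)) = of_real (exp (- (\<theta>\<^sup>2 / 2) * u powr (2 * H)))"
proof -
  interpret R: prob_space R by fact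
  have meas[measurable]: "W u \<in> borel_measurable R"
    and mean: "(LINT \<omega>|R. W u \<omega>) = 0"
    and G: "gaussian_process R W"
    using W u by (auto simp: fractional_brownian_motion_def process_def)
  have "(LINT \<omega>|R. W u \<omega> * W u \<omega>) = (u powr (2 * H) + u powr (2 * H) - \<bar>u - u\<bar> powr (2 * H)) / 2"
    using W u unfolding fractional_brownian_motion_def by blast
  then have second_moment: "(LINT \<omega>|R. W u \<omega> * W u \<omega>) = u powr (2 * H)"
    by simp
  have "gaussian_rv R (W u)"
    using G[unfolded gaussian_process_def, rule_format, of "{u}" "\<lambda>_. 1"] u by simp
  then consider m where "AE \<omega> in R. W u \<omega> = m"
    | m \<sigma> where "0 < \<sigma>" "distributed R lborel (W u) (normal_density m \<sigma>)"
    unfolding gaussian_rv_def by blast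
  then show ?thesis
  proof cases
    case 1
    have "(LINT \<omega>|R. W u \<omega>) = (LINT \<omega>|R. m)"
      using 1 by (intro integral_cong_AE) auto
    then have m: "m = 0" using mean by (simp add: R.prob_space)
    have "(LINT \<omega>|R. W u \<omega> * W u \<omega>) = (LINT \<omega>|R. 0)"
      using 1 by (intro integral_cong_AE) (auto simp: m)
    then have "u powr (2 * H) = 0" using second_moment by simp
    moreover have "(CLINT \<omega>|R. iexp (\<theta> * W u \<omega>)) = (CLINT \<omega>|R. 1)"
      using 1 by (intro integral_cong_AE) (auto simp: m)
    ultimately show ?thesis by (simp add: R.prob_space)
  next
    case 2
    have m: "m = 0"
      using R.normal_distributed_expectation[OF 2] mean by simp
    have "\<sigma>\<^sup>2 = u powr (2 * H)"
      using R.normal_distributed_variance[OF 2] mean second_moment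
      by (simp add: power2_eq_square)
    then show ?thesis
      using R.expectation_iexp_normal[OF _ 2(1)] 2(2) m by simp
  qed
qed

section \<open>The inverse process\<close>

text \<open>
  On monotone paths the first passage time only depends on the values at rational times, which
  makes it a measurable function of the path in the product space.
\<close>

definition rational_passage_time :: "real \<Rightarrow> (real \<Rightarrow> real) \<Rightarrow> real" where
  "rational_passage_time x f =
     (if \<exists>q\<in>\<rat> \<inter> {0..}. x < f q then Inf {q \<in> \<rat> \<inter> {0..}. x < f q} else 0)"

text \<open>An infimum lies strictly below u iff some element of the set does; the second disjunct
  accounts for the default value 0. Only countably many coordinates of f occur, which yields
  measurability in the product space.\<close>

lemma rational_passage_time_less_iff:
  "rational_passage_time x f < u \<longleftrightarrow>
     (\<exists>q\<in>\<rat> \<inter> {0..}. x < f q \<and> q < u) \<or> ((\<forall>q\<in>\<rat> \<inter> {0..}. \<not> x < f q) \<and> 0 < u)"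
proof (cases "\<exists>q\<in>\<rat> \<inter> {0..}. x < f q")
  case True
  then have "{q \<in> \<rat> \<inter> {0..}. x < f q} \<noteq> {}" by auto
  moreover have "bdd_below {q \<in> \<rat> \<inter> {0..}. x < f q}"
    by (rule bdd_belowI[of _ 0]) simp
  ultimately have "Inf {q \<in> \<rat> \<inter> {0..}. x < f q} < u \<longleftrightarrow> (\<exists>q\<in>{q \<in> \<rat> \<inter> {0..}. x < f q}. q < u)"
    by (rule cInf_less_iff)
  moreover have "rational_passage_time x f = Inf {q \<in> \<rat> \<inter> {0..}. x < f q}"
    using True unfolding rational_passage_time_def by (rule if_P)
  ultimately show ?thesis
    using True by auto
next
  case False
  then have "rational_passage_time x f = 0"
    unfolding rational_passage_time_def by (rule if_not_P)
  with False show ?thesis by auto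
qed

lemma measurable_rational_passage_time[measurable]:
  "rational_passage_time x \<in> borel_measurable (PiM {0..} (\<lambda>_. borel))"
proof (rule borel_measurableI_less)
  fix u :: real
  let ?M = "PiM {0..} (\<lambda>_. borel :: real measure)"
  have countable: "countable (\<rat> \<inter> {0::real..})"
    using countable_rat by (rule countable_Int1)
  have above: "{f \<in> space ?M. x < f q} \<in> sets ?M" if "q \<in> \<rat> \<inter> {0..}" for q
  proof -
    have [measurable]: "(\<lambda>f. f q) \<in> borel_measurable ?M"
      using that by (intro measurable_component_singleton) simp
    show ?thesis by measurable
  qed
  show "{f \<in> space ?M. rational_passage_time x f < u} \<in> sets ?M"
    unfolding rational_passage_time_less_iff
    by (intro sets.sets_Collect_disj sets.sets_Collect_conj sets.sets_Collect_const sets.sets_Collect_neg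
        sets.sets_Collect_countable_Ex'[OF _ countable] sets.sets_Collect_countable_All'[OF _ countable] above)
qed

text \<open>By monotonicity the path still exceeds x at every time after t once it does at t, so t
  can be replaced by rationals arbitrarily close to its right without changing the infimum.\<close>

lemma inverse_process_eq_rational_passage_time:
  assumes mono: "mono_on {0..} (\<lambda>t. S t \<omega>)"
  shows "inverse_process S x \<omega> = rational_passage_time x (\<lambda>t\<in>{0..}. S t \<omega>)"
proof -
  let ?A = "{t. 0 \<le> t \<and> x < S t \<omega>}" and ?B = "{q \<in> \<rat> \<inter> {0..}. x < S q \<omega>}"
  have rational_above: "\<exists>q\<in>?B. q < r" if "t \<in> ?A" "t < r" for t r
  proof -
    obtain q where "q \<in> \<rat>" "t < q" "q < r"
      using Rats_dense_in_real[OF \<open>t < r\<close>] by auto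
    moreover have "S t \<omega> \<le> S q \<omega>"
      using that \<open>t < q\<close> by (intro mono_onD[OF mono]) auto
    ultimately show ?thesis using that by (intro bexI[of _ q]) auto
  qed
  have ex_iff: "(\<exists>t\<ge>0. x < S t \<omega>) \<longleftrightarrow> (\<exists>q\<in>\<rat> \<inter> {0..}. x < (\<lambda>t\<in>{0..}. S t \<omega>) q)"
  proof
    assume "\<exists>t\<ge>0. x < S t \<omega>"
    then obtain t where "t \<in> ?A" by auto
    from rational_above[OF this, of "t + 1"] show "\<exists>q\<in>\<rat> \<inter> {0..}. x < (\<lambda>t\<in>{0..}. S t \<omega>) q"
      by auto
  qed auto
  have Inf_eq: "Inf ?A = Inf ?B" if "\<exists>t\<ge>0. x < S t \<omega>"
  proof (rule antisym)
    have A_ne: "?A \<noteq> {}" using that by auto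
    then have B_ne: "?B \<noteq> {}" using rational_above[of _ "_ + 1"] by (metis (no_types, lifting) equals0I empty_iff less_add_one)
    have bdd: "bdd_below ?A" "bdd_below ?B"
      by (auto intro: bdd_belowI[of _ 0])
    show "Inf ?A \<le> Inf ?B"
      using B_ne bdd by (intro cInf_superset_mono) auto
    show "Inf ?B \<le> Inf ?A"
    proof (rule cInf_greatest[OF A_ne])
      fix t assume t: "t \<in> ?A"
      show "Inf ?B \<le> t"
      proof (rule dense_ge)
        fix r assume "t < r"
        with rational_above[OF t] obtain q where "q \<in> ?B" "q < r" by blast
        then show "Inf ?B \<le> r"
          using cInf_lower[OF _ bdd(2), of q] by simp
      qed
    qed
  qed
  have "{q \<in> \<rat> \<inter> {0..}. x < (\<lambda>t\<in>{0..}. S t \<omega>) q} = ?B" by auto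
  with ex_iff Inf_eq show ?thesis
    unfolding inverse_process_def rational_passage_time_def by simp
qed

lemma inverse_process_nonneg: "0 \<le> inverse_process S x \<omega>"
  unfolding inverse_process_def by (auto intro!: cInf_greatest)

lemma measurable_path:
  assumes "process P X"
  shows "(\<lambda>\<omega>. \<lambda>t\<in>{0..}. X t \<omega>) \<in> P \<rightarrow>\<^sub>M PiM {0..} (\<lambda>_. borel)"
  using assms by (intro measurable_restrict) (auto simp: process_def)

lemma stable_subordinator_inverse_process:
  assumes "stable_subordinator Q \<beta> S" "\<omega> \<in> space Q"
  shows "inverse_process S x \<omega> = rational_passage_time x (\<lambda>t\<in>{0..}. S t \<omega>)"
  using assms by (intro inverse_process_eq_rational_passage_time) (auto simp: stable_subordinator_def)

lemma measurable_inverse_process: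
  assumes "stable_subordinator Q \<beta> S"
  shows "inverse_process S x \<in> borel_measurable Q"
proof -
  have "process Q S"
    using assms by (simp add: stable_subordinator_def levy_process_def)
  from measurable_compose[OF measurable_path[OF this] measurable_rational_passage_time]
  have "(\<lambda>\<omega>. rational_passage_time x (\<lambda>t\<in>{0..}. S t \<omega>)) \<in> borel_measurable Q" .
  then show ?thesis
    by (subst measurable_cong[OF stable_subordinator_inverse_process[OF assms]])
qed

section \<open>The law of the inverse process\<close>

lemma (in finite_borel_measure) le_cdf_if_le_cdf_right:
  assumes "\<And>w. u < w \<Longrightarrow> c \<le> cdf M w"
  shows "c \<le> cdf M u"
proof (rule tendsto_lowerbound)
  show "(cdf M \<longlongrightarrow> cdf M u) (at_right u)"
    using cdf_is_right_cont by (simp add: continuous_within)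
  show "\<forall>\<^sub>F w in at_right u. c \<le> cdf M w"
    using assms by (auto simp: eventually_at_filter)
qed simp

text \<open>As powr (-\<beta>) is decreasing on positive numbers, x < S w means w (S w) powr
  (-\<beta>) < w v with v = x powr (-\<beta>). Self-similarity replaces time w on the left by time
  v; taking the level v itself as the new time makes v cancel.\<close>

lemma stable_subordinator_prob_exceeds:
  assumes "prob_space Q" and \<beta>: "0 < \<beta>" and S: "stable_subordinator Q \<beta> S"
    and x: "0 < x" and w: "0 < w"
  shows "measure Q {\<omega> \<in> space Q. x < S w \<omega>}
    = measure Q {\<omega> \<in> space Q. S (x powr (- \<beta>)) \<omega> powr (- \<beta>) < w}"
proof -
  interpret Q: prob_space Q by fact
  define v where "v = x powr (- \<beta>)"
  have v: "0 < v" using x by (simp add: v_def)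
  have [measurable]: "S w \<in> borel_measurable Q" "S v \<in> borel_measurable Q"
    using stable_subordinatorD(1)[OF S] v w by simp_all
  have pos: "AE \<omega> in Q. 0 < S w \<omega>"
    by (rule Q.AE_pos_of_stretched_exp_laplace[OF stable_subordinatorD[OF S less_imp_le[OF w]] \<beta> w])
  have "measure Q {\<omega> \<in> space Q. x < S w \<omega>} = measure Q {\<omega> \<in> space Q. w * S w \<omega> powr (- \<beta>) < w * v}"
  proof (rule measure_eq_AE)
    show "AE \<omega> in Q. \<omega> \<in> {\<omega> \<in> space Q. x < S w \<omega>} \<longleftrightarrow> \<omega> \<in> {\<omega> \<in> space Q. w * S w \<omega> powr (- \<beta>) < w * v}"
      using pos
    proof eventually_elim
      case (elim \<omega>)
      have "x < S w \<omega> \<longleftrightarrow> S w \<omega> powr (- \<beta>) < v"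
        using elim x \<beta> powr_less_mono2_neg[of "- \<beta>" x "S w \<omega>"] powr_mono2'[of "- \<beta>" "S w \<omega>" x]
        unfolding v_def by (cases "x < S w \<omega>") auto
      then show ?case using w by simp
    qed
  qed simp_all
  also have "\<dots> = measure (distr Q borel (\<lambda>\<omega>. w * S w \<omega> powr (- \<beta>))) {..<w * v}"
    by (subst measure_distr) (auto intro!: arg_cong[where f = "measure Q"])
  also have "\<dots> = measure (distr Q borel (\<lambda>\<omega>. v * S v \<omega> powr (- \<beta>))) {..<w * v}"
    by (subst stable_subordinator_self_similar[OF \<open>prob_space Q\<close> \<beta> S w v]) simp
  also have "\<dots> = measure Q {\<omega> \<in> space Q. v * S v \<omega> powr (- \<beta>) < w * v}"
    by (subst measure_distr) (auto intro!: arg_cong[where f = "measure Q"])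
  also have "\<dots> = measure Q {\<omega> \<in> space Q. S v \<omega> powr (- \<beta>) < w}"
    using v by (simp add: mult.commute[of v])
  finally show ?thesis by (simp add: v_def)
qed

text \<open>Almost surely E < w implies x < S w, which implies E \<le> w. Since x < S w has the
  probability of Z < w, the two distribution functions bound each other at u and any w > u, and
  right continuity closes the gap.\<close>

lemma distr_inverse_process:
  assumes "prob_space Q" and \<beta>: "0 < \<beta>" and S: "stable_subordinator Q \<beta> S" and x: "0 < x"
  shows "distr Q borel (inverse_process S x)
    = distr Q borel (\<lambda>\<omega>. S (x powr (- \<beta>)) \<omega> powr (- \<beta>))"
proof -
  interpret Q: prob_space Q by fact
  define E where "E = inverse_process S x"
  define Z where "Z \<omega> = S (x powr (- \<beta>)) \<omega> powr (- \<beta>)" for \<omega>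
  have meas_S[measurable]: "S w \<in> borel_measurable Q" if "0 \<le> w" for w
    using stable_subordinatorD(1)[OF S that] .
  have [measurable]: "E \<in> borel_measurable Q"
    unfolding E_def using S by (rule measurable_inverse_process)
  have [measurable]: "Z \<in> borel_measurable Q"
    unfolding Z_def using x by measurable
  have mono: "S r \<omega> \<le> S w \<omega>" if "\<omega> \<in> space Q" "0 \<le> r" "r \<le> w" for r w \<omega>
    using S that by (auto simp: stable_subordinator_def intro: mono_onD[of "{0..}" "\<lambda>t. S t \<omega>"])
  have exceeds: "Q.prob {\<omega> \<in> space Q. x < S w \<omega>} = Q.prob {\<omega> \<in> space Q. Z \<omega> < w}" if "0 < w" for w
    unfolding Z_def using assms that by (intro stable_subordinator_prob_exceeds)
  interpret E: real_distribution "distr Q borel E"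
    by (rule Q.real_distribution_distr) simp
  interpret Z: real_distribution "distr Q borel Z"
    by (rule Q.real_distribution_distr) simp
  have cdf_E: "cdf (distr Q borel E) u = Q.prob {\<omega> \<in> space Q. E \<omega> \<le> u}" for u
    unfolding cdf_def by (subst measure_distr) (auto intro!: arg_cong[where f = Q.prob])
  have cdf_Z: "cdf (distr Q borel Z) u = Q.prob {\<omega> \<in> space Q. Z \<omega> \<le> u}" for u
    unfolding cdf_def by (subst measure_distr) (auto intro!: arg_cong[where f = Q.prob])
  have E_le: "E \<omega> \<le> w" if "0 \<le> w" "x < S w \<omega>" for w \<omega>
    using that unfolding E_def inverse_process_def
    by (auto intro!: cInf_lower bdd_belowI[of _ 0])
  \<comment> \<open>Paths that never exceed x carry the default value E = 0, for which E < w would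
    not imply x < S w. They are null because the distribution function of Z tends to 1; passing from
    k to k + 1 makes the inequality strict and the time positive.\<close>
  have finite: "AE \<omega> in Q. \<exists>k::nat. x < S (real k) \<omega>"
  proof -
    have "cdf (distr Q borel Z) (real k) \<le> Q.prob {\<omega> \<in> space Q. \<exists>k::nat. x < S (real k) \<omega>}" for k
    proof -
      have "cdf (distr Q borel Z) (real k) \<le> Q.prob {\<omega> \<in> space Q. Z \<omega> < real (Suc k)}"
        unfolding cdf_Z by (rule Q.finite_measure_mono) auto
      also have "\<dots> = Q.prob {\<omega> \<in> space Q. x < S (real (Suc k)) \<omega>}"
        by (rule exceeds[symmetric]) simp
      also have "\<dots> \<le> Q.prob {\<omega> \<in> space Q. \<exists>k::nat. x < S (real k) \<omega>}"
        by (rule Q.finite_measure_mono) (blast, measurable)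
      finally show ?thesis .
    qed
    moreover have "(\<lambda>k. cdf (distr Q borel Z) (real k)) \<longlonglongrightarrow> 1"
      by (rule filterlim_compose[OF Z.cdf_lim_at_top_prob filterlim_real_sequentially])
    ultimately have "1 \<le> Q.prob {\<omega> \<in> space Q. \<exists>k::nat. x < S (real k) \<omega>}"
      by (intro LIMSEQ_le_const2) auto
    then have "Q.prob {\<omega> \<in> space Q. \<exists>k::nat. x < S (real k) \<omega>} = 1"
      using Q.prob_le_1 by (intro antisym)
    then show ?thesis
      by (subst (asm) Q.prob_Collect_eq_1) measurable
  qed
  have E_less: "x < S w \<omega>" if \<omega>: "\<omega> \<in> space Q" "\<exists>k::nat. x < S (real k) \<omega>" and w: "E \<omega> < w" for w \<omega>
  proof -
    from \<omega> obtain k :: nat where "x < S (real k) \<omega>" by blast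
    then have ex: "\<exists>t\<ge>0. x < S t \<omega>" by (intro exI[of _ "real k"]) simp
    then have "Inf {t. 0 \<le> t \<and> x < S t \<omega>} < w"
      using w by (simp add: E_def inverse_process_def)
    then obtain r where "0 \<le> r" "x < S r \<omega>" "r < w"
      using ex by (subst (asm) cInf_less_iff) (auto intro: bdd_belowI[of _ 0])
    with mono[OF \<omega>(1), of r w] show ?thesis by simp
  qed
  have "cdf (distr Q borel E) u = cdf (distr Q borel Z) u" for u
  proof (cases "0 \<le> u")
    case False
    have "0 \<le> E \<omega>" "0 \<le> Z \<omega>" for \<omega>
      by (simp_all add: E_def Z_def inverse_process_nonneg)
    with False have "{\<omega> \<in> space Q. E \<omega> \<le> u} = {}" "{\<omega> \<in> space Q. Z \<omega> \<le> u} = {}"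
      by (auto simp: not_le intro: less_le_trans)
    then show ?thesis by (simp only: cdf_E cdf_Z)
  next
    case True
    have le: "cdf (distr Q borel E) u \<le> cdf (distr Q borel Z) w" if "u < w" for w
    proof -
      have [measurable]: "S w \<in> borel_measurable Q" using True that by simp
      have "cdf (distr Q borel E) u \<le> Q.prob {\<omega> \<in> space Q. x < S w \<omega>}"
        unfolding cdf_E
      proof (rule Q.finite_measure_mono_AE)
        show "AE \<omega> in Q. \<omega> \<in> {\<omega> \<in> space Q. E \<omega> \<le> u} \<longrightarrow> \<omega> \<in> {\<omega> \<in> space Q. x < S w \<omega>}"
          using finite by eventually_elim (use E_less that in auto)
      qed simp
      also have "\<dots> = Q.prob {\<omega> \<in> space Q. Z \<omega> < w}"
        using True that by (intro exceeds) simp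
      also have "\<dots> \<le> cdf (distr Q borel Z) w"
        unfolding cdf_Z by (rule Q.finite_measure_mono) auto
      finally show ?thesis .
    qed
    have ge: "cdf (distr Q borel Z) u \<le> cdf (distr Q borel E) w" if "u < w" for w
    proof -
      have "cdf (distr Q borel Z) u \<le> Q.prob {\<omega> \<in> space Q. Z \<omega> < w}"
        unfolding cdf_Z using that by (intro Q.finite_measure_mono) auto
      also have "\<dots> = Q.prob {\<omega> \<in> space Q. x < S w \<omega>}"
        using True that by (intro exceeds[symmetric]) simp
      also have "\<dots> \<le> cdf (distr Q borel E) w"
        unfolding cdf_E using True that E_le by (intro Q.finite_measure_mono) auto
      finally show ?thesis .
    qed
    show ?thesis
      using Z.le_cdf_if_le_cdf_right[OF le] E.le_cdf_if_le_cdf_right[OF ge] by (rule antisym)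
  qed
  then have "distr Q borel E = distr Q borel Z"
    using cdf_unique[OF E.real_distribution_axioms Z.real_distribution_axioms] by blast
  then show ?thesis by (simp add: E_def Z_def[abs_def])
qed

section \<open>Equalities in law\<close>

lemma mittag_leffler_1: "mittag_leffler 1 x = exp x"
proof -
  have "Gamma (1 * real n + 1) = fact n" for n
    using Gamma_fact[of n, where 'a = real] by (simp add: add.commute)
  then show ?thesis
    by (simp add: mittag_leffler_def exp_def divide_inverse mult.commute)
qed

text \<open>The density of \<open>D x\<close> is \<open>M\<close> dilated by c = x powr (-\<beta>),
  so the substitution \<tau> = c y leads to the Laplace transform of \<open>M\<close> at s x powr
  \<beta>. For \<beta> = 1 the point mass at x gives exp(-s x), the Mittag-Leffler function of index
  1.\<close>

lemma M_Wright_marginals_laplace: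
  assumes "prob_space R" and D: "M_Wright_marginals R \<beta> M D"
    and M: "\<beta> < 1 \<Longrightarrow> M_Wright_density \<beta> M" and \<beta>: "0 < \<beta>" "\<beta> \<le> 1" and x: "0 < x"
  shows "AE \<omega> in R. 0 \<le> D x \<omega>"
    and "0 \<le> s \<Longrightarrow> (LINT \<omega>|R. exp (- s * D x \<omega>)) = mittag_leffler \<beta> (- (s * x powr \<beta>))"
proof -
  interpret R: prob_space R by fact
  have [measurable]: "D x \<in> borel_measurable R"
    using D x by (simp add: M_Wright_marginals_def process_def)
  have "(AE \<omega> in R. 0 \<le> D x \<omega>) \<and> (0 \<le> s \<longrightarrow>
    (LINT \<omega>|R. exp (- s * D x \<omega>)) = mittag_leffler \<beta> (- (s * x powr \<beta>)))"
  proof (cases "\<beta> = 1")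
    case True
    then have distr: "distr R borel (D x) = return borel x"
      using D x by (simp add: M_Wright_marginals_def)
    have "AE y in distr R borel (D x). 0 \<le> y"
      unfolding distr using x by (subst AE_return) auto
    then have "AE \<omega> in R. 0 \<le> D x \<omega>"
      by (subst (asm) AE_distr_iff) auto
    moreover have "(LINT \<omega>|R. exp (- s * D x \<omega>)) = (LINT y|distr R borel (D x). exp (- s * y))"
      by (subst integral_distr) auto
    then have "(LINT \<omega>|R. exp (- s * D x \<omega>)) = exp (- s * x)"
      unfolding distr by (subst (asm) integral_return) auto
    ultimately show ?thesis using True x by (simp add: mittag_leffler_1)
  next
    case False
    with \<beta> M have M: "M_Wright_density \<beta> M" by simp
    then have [measurable]: "M \<in> borel_measurable borel" and M_nonneg: "\<And>\<tau>. 0 \<le> \<tau> \<Longrightarrow> 0 \<le> M \<tau>"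
      by (auto simp: M_Wright_density_def)
    define c where "c = x powr (- \<beta>)"
    have c: "0 < c" using x by (simp add: c_def)
    have c_inv: "s * x powr \<beta> * c = s" for s
      using x by (simp add: c_def powr_minus field_simps)
    define f where "f y = indicator {0..} y * (c * M (y * c))" for y :: real
    have f_nonneg: "0 \<le> f y" for y
      using M_nonneg c by (auto simp: f_def split: split_indicator)
    have f: "distributed R lborel (D x) f"
      using D x False unfolding M_Wright_marginals_def f_def c_def by simp
    have [measurable]: "f \<in> borel_measurable borel"
      unfolding f_def by measurable
    have "AE \<omega> in R. 0 \<le> D x \<omega>"
      by (subst R.distributed_AE2[OF f]) (auto simp: f_def split: split_indicator)
    moreover have "(LINT \<omega>|R. exp (- s * D x \<omega>)) = mittag_leffler \<beta> (- (s * x powr \<beta>))" if "0 \<le> s"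
    proof -
      have "(LINT \<omega>|R. exp (- s * D x \<omega>)) = (LINT y|lborel. f y * exp (- s * y))"
        using f_nonneg by (intro distributed_integral[OF f, symmetric]) simp_all
      \<comment> \<open>The exponent is rewritten by s = s x powr \<beta> c, so that everything
        depends on c y; the offset 0 matches the form of the affine substitution rule.\<close>
      also have "\<dots> = \<bar>c\<bar> *\<^sub>R (LINT y|lborel. indicator {0..} (0 + c * y) *\<^sub>R (exp (- (s * x powr \<beta>) * (0 + c * y)) * M (0 + c * y)))"
      proof -
        have "f y * exp (- s * y) = c * (indicator {0..} (0 + c * y) *\<^sub>R (exp (- (s * x powr \<beta>) * (0 + c * y)) * M (0 + c * y)))" for y
          using c c_inv[of s] by (auto simp: f_def zero_le_mult_iff mult_ac split: split_indicator)
        then show ?thesis using c by simp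
      qed
      also have "\<dots> = (LINT \<tau>|lborel. indicator {0..} \<tau> *\<^sub>R (exp (- (s * x powr \<beta>) * \<tau>) * M \<tau>))"
        using c by (intro lborel_integral_real_affine[symmetric]) simp
      also have "\<dots> = mittag_leffler \<beta> (- (s * x powr \<beta>))"
        using M that by (auto simp: M_Wright_density_def set_lebesgue_integral_def)
      finally show ?thesis .
    qed
    ultimately show ?thesis by blast
  qed
  then show "AE \<omega> in R. 0 \<le> D x \<omega>"
    "0 \<le> s \<Longrightarrow> (LINT \<omega>|R. exp (- s * D x \<omega>)) = mittag_leffler \<beta> (- (s * x powr \<beta>))"
    by auto
qed

text \<open>Independence of whole paths passes to a coordinate of one and a measurable functional of
  the other. Agreement of \<open>T\<close> with the functional is asked on \<open>space P\<close>
  only, since that is where the inverse process is identified with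
  \<open>rational_passage_time\<close>.\<close>

lemma indep_processes_functional:
  assumes "prob_space P" and indep: "indep_processes P X Y" and u: "0 \<le> u"
    and f: "f \<in> borel_measurable (PiM {0..} (\<lambda>_. borel))"
    and T: "\<And>\<omega>. \<omega> \<in> space P \<Longrightarrow> T \<omega> = f (\<lambda>t\<in>{0..}. Y t \<omega>)"
  shows "prob_space.indep_var P borel (X u) borel T"
proof -
  interpret P: prob_space P by fact
  let ?T = "\<lambda>\<omega>. f (\<lambda>t\<in>{0..}. Y t \<omega>)"
  have "P.indep_var borel ((\<lambda>p. p u) \<circ> (\<lambda>\<omega>. \<lambda>t\<in>{0..}. X t \<omega>)) borel (f \<circ> (\<lambda>\<omega>. \<lambda>t\<in>{0..}. Y t \<omega>))"
    using u by (intro P.indep_var_compose[OF indep[unfolded indep_processes_def] _ f] measurable_component_singleton) simp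
  then have "P.indep_var borel (X u) borel ?T"
    using u by (simp add: comp_def)
  moreover have "T -` A \<inter> space P = ?T -` A \<inter> space P" for A
    using T by auto
  moreover have "T \<in> borel_measurable P \<longleftrightarrow> ?T \<in> borel_measurable P"
    using T by (rule measurable_cong)
  ultimately show ?thesis
    unfolding P.indep_var_eq by simp
qed

lemma eq_in_law_if_char_eq:
  assumes "prob_space P" "prob_space Q" "X \<in> borel_measurable P" "Y \<in> borel_measurable Q"
    and "\<And>\<theta>. (CLINT \<omega>|P. iexp (\<theta> * X \<omega>)) = (CLINT \<omega>|Q. iexp (\<theta> * Y \<omega>))"
  shows "eq_in_law P X Q Y"
proof -
  have "char (distr P borel X) = char (distr Q borel Y)"
    using assms(5) by (simp only: char_distr[OF assms(3)] char_distr[OF assms(4)] fun_eq_iff) simp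
  with assms show ?thesis
    by (simp add: eq_in_law_def Levy_uniqueness prob_space.real_distribution_distr)
qed

theorem mainTheorem6:
  fixes \<alpha> \<beta> H t :: real
    and P :: "'a measure" and X :: "real \<Rightarrow> 'a \<Rightarrow> real"
    and Q :: "'b measure" and B S :: "real \<Rightarrow> 'b \<Rightarrow> real"
    and R :: "'c measure" and B\<^sub>H D :: "real \<Rightarrow> 'c \<Rightarrow> real"
    and M :: "real \<Rightarrow> real"
  assumes "0 < \<alpha>" "\<alpha> < 2" "0 < \<beta>" "\<beta> \<le> 1" "H = \<alpha> / 2"
    and "prob_space P" "grey_brownian_motion P \<alpha> \<beta> X"
    and "prob_space Q" "stable_subordinator Q \<beta> S" "brownian_motion Q B" "indep_processes Q B S"
    and "\<beta> < 1 \<Longrightarrow> M_Wright_density \<beta> M"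
    and "prob_space R" "fractional_brownian_motion R H B\<^sub>H" "M_Wright_marginals R \<beta> M D"
        "indep_processes R B\<^sub>H D"
    and "0 < t"
  shows "eq_in_law P (X t) Q (\<lambda>\<omega>. B (inverse_process S (t powr (\<alpha> / \<beta>)) \<omega>) \<omega>)
    \<and> eq_in_law Q (\<lambda>\<omega>. B (inverse_process S (t powr (\<alpha> / \<beta>)) \<omega>) \<omega>)
                   Q (\<lambda>\<omega>. B (S (t powr (-\<alpha>)) \<omega> powr (-\<beta>)) \<omega>)
    \<and> eq_in_law P (X t) R (\<lambda>\<omega>. B\<^sub>H (D (t powr (\<alpha> / \<beta>)) \<omega> powr (1 / \<alpha>)) \<omega>)"
proof -
  interpret P: prob_space P by fact
  interpret Q: prob_space Q by fact
  interpret R: prob_space R by fact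
  define x where "x = t powr (\<alpha> / \<beta>)"
  define v where "v = t powr (- \<alpha>)"
  \<comment> \<open>The common characteristic function of all four random variables.\<close>
  define L where "L \<theta> = complex_of_real (mittag_leffler \<beta> (- (\<theta>\<^sup>2 / 2) * t powr \<alpha>))" for \<theta>
  have x: "0 < x" and v: "0 < v" and x_v: "x powr (- \<beta>) = v" and x_\<beta>: "x powr \<beta> = t powr \<alpha>"
    and v_inv: "\<And>a. a / v = a * t powr \<alpha>"
    using assms by (simp_all add: x_def v_def powr_powr powr_minus field_simps)
  have X: "X t \<in> borel_measurable P" "\<And>\<theta>. (CLINT \<omega>|P. iexp (\<theta> * X t \<omega>)) = L \<theta>"
    using assms unfolding grey_brownian_motion_def process_def L_def by auto

  have B_meas: "\<And>u. 0 \<le> u \<Longrightarrow> B u \<in> borel_measurable Q"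
    and B_cont: "\<And>\<omega>. \<omega> \<in> space Q \<Longrightarrow> continuous_on {0..} (\<lambda>u. B u \<omega>)"
    using assms by (auto simp: brownian_motion_def process_def)
  define E where "E = inverse_process S x"
  define Z where "Z \<omega> = S v \<omega> powr (- \<beta>)" for \<omega>
  have S_v: "S v \<in> borel_measurable Q" "AE \<omega> in Q. 0 \<le> S v \<omega>"
    "\<And>s. 0 \<le> s \<Longrightarrow> (LINT \<omega>|Q. exp (- s * S v \<omega>)) = exp (- v * s powr \<beta>)"
    using stable_subordinatorD[OF assms(9) less_imp_le[OF v]] by blast+
  have E_meas[measurable]: "E \<in> borel_measurable Q" and Z_meas[measurable]: "Z \<in> borel_measurable Q"
    using measurable_inverse_process[OF assms(9)] S_v(1) unfolding E_def Z_def by simp_all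
  have E_nonneg: "0 \<le> E \<omega>" and Z_nonneg: "0 \<le> Z \<omega>" for \<omega>
    by (simp_all add: E_def Z_def inverse_process_nonneg)
  \<comment> \<open>The powers of t are arranged so that x powr (-\<beta>) = v: the inverse at level
    x is compared with S at time t powr (-\<alpha>).\<close>
  have law_E: "distr Q borel E = distr Q borel Z"
    using distr_inverse_process[OF assms(8) \<open>0 < \<beta>\<close> assms(9) x] by (simp add: E_def Z_def[abs_def] x_v)
  have laplace_Z: "(LINT \<omega>|Q. exp (s * Z \<omega>)) = mittag_leffler \<beta> (s * t powr \<alpha>)" for s
    unfolding Z_def v_inv[symmetric] using S_v \<open>0 < \<beta>\<close> v
    by (rule Q.expectation_exp_negative_power_eq_mittag_leffler)
  have laplace_E: "(LINT \<omega>|Q. exp (s * E \<omega>)) = mittag_leffler \<beta> (s * t powr \<alpha>)" for s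
  proof -
    have "(LINT \<omega>|Q. exp (s * E \<omega>)) = (LINT y|distr Q borel E. exp (s * y))"
      by (rule integral_distr[symmetric]) simp_all
    also have "\<dots> = (LINT \<omega>|Q. exp (s * Z \<omega>))"
      unfolding law_E by (rule integral_distr) simp_all
    finally show ?thesis by (simp only: laplace_Z)
  qed
  have indep_E: "Q.indep_var borel (B u) borel E" if "0 \<le> u" for u
    using indep_processes_functional[OF assms(8,11) that measurable_rational_passage_time]
      stable_subordinator_inverse_process[OF assms(9)]
    unfolding E_def by blast
  have indep_Z: "Q.indep_var borel (B u) borel Z" if "0 \<le> u" for u
  proof (rule indep_processes_functional[OF assms(8,11) that])
    have "(\<lambda>p. p v) \<in> borel_measurable (PiM {0..} (\<lambda>_. borel :: real measure))"
      using v by (intro measurable_component_singleton) simp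
    then show "(\<lambda>p. p v powr (- \<beta>)) \<in> borel_measurable (PiM {0..} (\<lambda>_. borel))"
      by measurable
    show "Z \<omega> = (\<lambda>t\<in>{0..}. S t \<omega>) v powr (- \<beta>)" for \<omega>
      using v by (simp add: Z_def)
  qed
  note char_B = brownian_motion_expectation_iexp[OF assms(8,10)]
  have BE: "(\<lambda>\<omega>. B (E \<omega>) \<omega>) \<in> borel_measurable Q"
    by (rule Q.measurable_at_random_time[OF B_meas B_cont E_meas E_nonneg])
  have BZ: "(\<lambda>\<omega>. B (Z \<omega>) \<omega>) \<in> borel_measurable Q"
    by (rule Q.measurable_at_random_time[OF B_meas B_cont Z_meas Z_nonneg])
  \<comment> \<open>The variance function of Brownian motion is the identity, so the Laplace
    transform of the random time is evaluated at \<theta>^2/2.\<close>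
  have char_BE: "(CLINT \<omega>|Q. iexp (\<theta> * B (E \<omega>) \<omega>)) = L \<theta>" for \<theta>
    using Q.expectation_iexp_at_random_time[OF B_meas B_cont E_meas E_nonneg indep_E char_B continuous_on_id]
    by (simp only: laplace_E L_def)
  have char_BZ: "(CLINT \<omega>|Q. iexp (\<theta> * B (Z \<omega>) \<omega>)) = L \<theta>" for \<theta>
    using Q.expectation_iexp_at_random_time[OF B_meas B_cont Z_meas Z_nonneg indep_Z char_B continuous_on_id]
    by (simp only: laplace_Z L_def)

  have BH_meas: "\<And>u. 0 \<le> u \<Longrightarrow> B\<^sub>H u \<in> borel_measurable R"
    and BH_cont: "\<And>\<omega>. \<omega> \<in> space R \<Longrightarrow> continuous_on {0..} (\<lambda>u. B\<^sub>H u \<omega>)"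
    using assms by (auto simp: fractional_brownian_motion_def process_def)
  define T where "T \<omega> = D x \<omega> powr (1 / \<alpha>)" for \<omega>
  have D_meas[measurable]: "D x \<in> borel_measurable R"
    using assms x by (auto simp: M_Wright_marginals_def process_def)
  have T_meas[measurable]: "T \<in> borel_measurable R"
    unfolding T_def by measurable
  have T_nonneg: "0 \<le> T \<omega>" for \<omega>
    by (simp add: T_def)
  have indep_T: "R.indep_var borel (B\<^sub>H u) borel T" if "0 \<le> u" for u
  proof (rule indep_processes_functional[OF assms(13,16) that])
    have "(\<lambda>p. p x) \<in> borel_measurable (PiM {0..} (\<lambda>_. borel :: real measure))"
      using x by (intro measurable_component_singleton) simp
    then show "(\<lambda>p. p x powr (1 / \<alpha>)) \<in> borel_measurable (PiM {0..} (\<lambda>_. borel))"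
      by measurable
    show "T \<omega> = (\<lambda>t\<in>{0..}. D t \<omega>) x powr (1 / \<alpha>)" for \<omega>
      using x by (simp add: T_def)
  qed
  have laplace_D: "AE \<omega> in R. 0 \<le> D x \<omega>"
    "\<And>s. 0 \<le> s \<Longrightarrow> (LINT \<omega>|R. exp (- s * D x \<omega>)) = mittag_leffler \<beta> (- (s * x powr \<beta>))"
    using M_Wright_marginals_laplace[OF assms(13,15) _ assms(3,4) x] assms(12) by blast+
  have char_BT: "(CLINT \<omega>|R. iexp (\<theta> * B\<^sub>H (T \<omega>) \<omega>)) = L \<theta>" for \<theta>
  proof -
    have "(CLINT \<omega>|R. iexp (\<theta> * B\<^sub>H (T \<omega>) \<omega>)) = of_real (LINT \<omega>|R. exp (- (\<theta>\<^sup>2 / 2) * T \<omega> powr \<alpha>))"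
    proof (rule R.expectation_iexp_at_random_time[OF BH_meas BH_cont T_meas T_nonneg indep_T])
      show "(CLINT \<omega>|R. iexp (\<theta> * B\<^sub>H u \<omega>)) = of_real (exp (- (\<theta>\<^sup>2 / 2) * u powr \<alpha>))" if "0 \<le> u" for u
        using fractional_brownian_motion_expectation_iexp[OF assms(13,14) that] assms(5) by simp
      show "continuous_on {0..} (\<lambda>u. u powr \<alpha>)"
        using \<open>0 < \<alpha>\<close> by (intro continuous_on_powr' continuous_intros) auto
    qed simp_all
    \<comment> \<open>The power 1/\<alpha> in the random time undoes the variance function u powr
      \<alpha>; recovering \<open>D x\<close> itself uses its almost sure nonnegativity.\<close>
    also have "(LINT \<omega>|R. exp (- (\<theta>\<^sup>2 / 2) * T \<omega> powr \<alpha>)) = (LINT \<omega>|R. exp (- (\<theta>\<^sup>2 / 2) * D x \<omega>))"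
    proof (rule integral_cong_AE)
      show "AE \<omega> in R. exp (- (\<theta>\<^sup>2 / 2) * T \<omega> powr \<alpha>) = exp (- (\<theta>\<^sup>2 / 2) * D x \<omega>)"
        using laplace_D(1) by eventually_elim (use \<open>0 < \<alpha>\<close> in \<open>simp add: T_def powr_powr\<close>)
    qed simp_all
    also have "\<dots> = mittag_leffler \<beta> (- (\<theta>\<^sup>2 / 2) * t powr \<alpha>)"
      by (subst laplace_D(2)) (simp_all add: x_\<beta>)
    finally show ?thesis by (simp only: L_def)
  qed
  have BT: "(\<lambda>\<omega>. B\<^sub>H (T \<omega>) \<omega>) \<in> borel_measurable R"
    by (rule R.measurable_at_random_time[OF BH_meas BH_cont T_meas T_nonneg])

  have "eq_in_law P (X t) Q (\<lambda>\<omega>. B (E \<omega>) \<omega>)"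
    by (rule eq_in_law_if_char_eq[OF assms(6,8) X(1) BE]) (simp only: X(2) char_BE)
  moreover have "eq_in_law Q (\<lambda>\<omega>. B (E \<omega>) \<omega>) Q (\<lambda>\<omega>. B (Z \<omega>) \<omega>)"
    by (rule eq_in_law_if_char_eq[OF assms(8,8) BE BZ]) (simp only: char_BE char_BZ)
  moreover have "eq_in_law P (X t) R (\<lambda>\<omega>. B\<^sub>H (T \<omega>) \<omega>)"
    by (rule eq_in_law_if_char_eq[OF assms(6,13) X(1) BT]) (simp only: X(2) char_BT)
  ultimately show ?thesis
    by (simp only: E_def Z_def T_def x_def v_def)
qed

end
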